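(* Let $M^m$ be a (connected) Riemannian manifold and let $\varphi:M^m\to\mathbb{E}^{m+1}$ be a Riemannian isometric embedding such that $\varphi(M^m)=\partial K$, where $K$ is a closed convex set in $\mathbb{E}^{m+1}$. Then $\varphi: M^m\to \mathrm{Cl}(\mathbb{E}^{m+1}\setminus K)$ is a metric isometric embedding, where $\mathrm{Cl}(\mathbb{E}^{m+1}\setminus K)$ (the closure of the complement of $K$) is endowed with its induced length metric.
   Context: $\mathbb{E}^{m+1}$ is Euclidean space. A Riemannian isometric embedding $\varphi:M\to N$ is a diffeomorphism onto its image with $|\varphi_*V|=|V|$ for all tangent vectors $V$ of $M$. A metric isometric embedding $\varphi:X\to Z$ between metric spaces is a map with $d_Z(\varphi(x_1),\varphi(x_2))=d_X(x_1,x_2)$ for all $x_1,x_2\in X$. A Riemannian manifold carries its Riemannian distance $d_M$. The induced length metric on a rectifiably connected subset $Y$ of a metric space $Z$ is $d_Y(y_1,y_2)=\inf$ of the lengths (measured with $d_Z$) of curves contained in $Y$ from $y_1$ to $y_2$. *)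

theory Defs
  imports "HOL-Analysis.Analysis"
begin

text \<open>
  Smoothness means \<open>C\<^sup>\<infinity>\<close>. The following notions are meant for open \<open>S\<close>, where the
  derivatives at interior points depend only on the values of \<open>f\<close> on \<open>S\<close>.
\<close>

primrec Ck_on :: "nat \<Rightarrow> 'a::real_normed_vector set \<Rightarrow> ('a \<Rightarrow> 'b::real_normed_vector) \<Rightarrow> bool" where
  "Ck_on 0 S f \<longleftrightarrow> continuous_on S f"
| "Ck_on (Suc k) S f \<longleftrightarrow>
     (\<forall>x\<in>S. f differentiable (at x)) \<and> (\<forall>v. Ck_on k S (\<lambda>x. frechet_derivative f (at x) v))"

definition smooth_on :: "'a::real_normed_vector set \<Rightarrow> ('a \<Rightarrow> 'b::real_normed_vector) \<Rightarrow> bool" where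
  "smooth_on S f \<longleftrightarrow> (\<forall>k. Ck_on k S f)"


section \<open>Smooth manifolds and Riemannian metrics\<close>

text \<open>
  A chart is a domain together with a coordinate map; the values of the coordinate map outside
  the domain are irrelevant. The dimension of the manifold is the dimension of the model
  space \<open>'b\<close>. Atlases are not required to be maximal: an atlas determines its smooth structure.
\<close>

type_synonym ('a, 'b) chart = "'a set \<times> ('a \<Rightarrow> 'b)"

abbreviation chart_dom :: "('a, 'b) chart \<Rightarrow> 'a set" where
  "chart_dom c \<equiv> fst c"

abbreviation chart_map :: "('a, 'b) chart \<Rightarrow> 'a \<Rightarrow> 'b" where
  "chart_map c \<equiv> snd c"

abbreviation chart_img :: "('a, 'b) chart \<Rightarrow> 'b set" where
  "chart_img c \<equiv> chart_map c ` chart_dom c"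

abbreviation chart_inv :: "('a, 'b) chart \<Rightarrow> 'b \<Rightarrow> 'a" where
  "chart_inv c \<equiv> inv_into (chart_dom c) (chart_map c)"

definition smooth_manifold :: "'a topology \<Rightarrow> ('a, 'b::euclidean_space) chart set \<Rightarrow> bool" where
  "smooth_manifold X A \<longleftrightarrow>
     Hausdorff_space X \<and> second_countable X \<and>
     (\<Union>c\<in>A. chart_dom c) = topspace X \<and>
     (\<forall>c\<in>A. openin X (chart_dom c) \<and> open (chart_img c) \<and>
        homeomorphic_map (subtopology X (chart_dom c)) (top_of_set (chart_img c)) (chart_map c)) \<and>
     (\<forall>c\<in>A. \<forall>c'\<in>A.
        smooth_on (chart_map c ` (chart_dom c \<inter> chart_dom c')) (chart_map c' \<circ> chart_inv c))"

text \<open>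
  A tangent vector at \<open>p\<close> is the family of its coordinate vectors in all charts around \<open>p\<close>; these
  are related by the Jacobians of the coordinate changes. The components at all other charts
  are set to \<open>0\<close>, so that each tangent vector has exactly one representation.
\<close>

type_synonym ('a, 'b) tangent = "('a, 'b) chart \<Rightarrow> 'b"

definition tangent_space ::
    "('a, 'b::euclidean_space) chart set \<Rightarrow> 'a \<Rightarrow> ('a, 'b) tangent set" where
  "tangent_space A p =
     {V. (\<forall>c. \<not> (c \<in> A \<and> p \<in> chart_dom c) \<longrightarrow> V c = 0) \<and>
         (\<forall>c\<in>A. \<forall>c'\<in>A. p \<in> chart_dom c \<and> p \<in> chart_dom c' \<longrightarrow>
            V c' = frechet_derivative (chart_map c' \<circ> chart_inv c) (at (chart_map c p)) (V c))}"

text \<open>The tangent vector at \<open>p\<close> with coordinate vector \<open>v\<close> in the chart \<open>c\<close>.\<close>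

definition coord_tangent ::
    "('a, 'b::euclidean_space) chart set \<Rightarrow> ('a, 'b) chart \<Rightarrow> 'a \<Rightarrow> 'b \<Rightarrow> ('a, 'b) tangent" where
  "coord_tangent A c p v =
     (\<lambda>c'. if c' \<in> A \<and> p \<in> chart_dom c'
           then frechet_derivative (chart_map c' \<circ> chart_inv c) (at (chart_map c p)) v else 0)"

definition riemannian_metric ::
    "'a topology \<Rightarrow> ('a, 'b::euclidean_space) chart set \<Rightarrow>
     ('a \<Rightarrow> ('a, 'b) tangent \<Rightarrow> ('a, 'b) tangent \<Rightarrow> real) \<Rightarrow> bool" where
  "riemannian_metric X A g \<longleftrightarrow>
     (\<forall>p\<in>topspace X.
        (\<forall>V\<in>tangent_space A p. \<forall>W\<in>tangent_space A p. g p V W = g p W V) \<and>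
        (\<forall>U\<in>tangent_space A p. \<forall>V\<in>tangent_space A p. \<forall>W\<in>tangent_space A p. \<forall>a.
           g p (\<lambda>c. a *\<^sub>R U c + V c) W = a * g p U W + g p V W) \<and>
        (\<forall>V\<in>tangent_space A p. V \<noteq> (\<lambda>c. 0) \<longrightarrow> 0 < g p V V)) \<and>
     (\<forall>c\<in>A. \<forall>v w. smooth_on (chart_img c)
        (\<lambda>x. g (chart_inv c x) (coord_tangent A c (chart_inv c x) v)
                               (coord_tangent A c (chart_inv c x) w)))"

definition riemannian_manifold ::
    "'a topology \<Rightarrow> ('a, 'b::euclidean_space) chart set \<Rightarrow>
     ('a \<Rightarrow> ('a, 'b) tangent \<Rightarrow> ('a, 'b) tangent \<Rightarrow> real) \<Rightarrow> bool" where
  "riemannian_manifold X A g \<longleftrightarrow> smooth_manifold X A \<and> riemannian_metric X A g"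

definition tangent_norm ::
    "('a \<Rightarrow> ('a, 'b) tangent \<Rightarrow> ('a, 'b) tangent \<Rightarrow> real) \<Rightarrow> 'a \<Rightarrow> ('a, 'b) tangent \<Rightarrow> real" where
  "tangent_norm g p V = sqrt (g p V V)"


section \<open>Riemannian distance\<close>

definition velocity ::
    "('a, 'b::euclidean_space) chart set \<Rightarrow> (real \<Rightarrow> 'a) \<Rightarrow> real \<Rightarrow> ('a, 'b) tangent" where
  "velocity A \<gamma> t =
     (\<lambda>c. if c \<in> A \<and> \<gamma> t \<in> chart_dom c then vector_derivative (chart_map c \<circ> \<gamma>) (at t) else 0)"

text \<open>Continuously differentiable on \<open>[a, b]\<close>, with one-sided derivatives at the end points.\<close>

definition C1_curve_on ::
    "('a, 'b::euclidean_space) chart set \<Rightarrow> (real \<Rightarrow> 'a) \<Rightarrow> real \<Rightarrow> real \<Rightarrow> bool" where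
  "C1_curve_on A \<gamma> a b \<longleftrightarrow>
     (\<forall>c\<in>A. (\<forall>t\<in>{a..b}. \<gamma> t \<in> chart_dom c \<longrightarrow>
                (chart_map c \<circ> \<gamma>) differentiable (at t within {a..b})) \<and>
             continuous_on {t\<in>{a..b}. \<gamma> t \<in> chart_dom c}
               (\<lambda>t. vector_derivative (chart_map c \<circ> \<gamma>) (at t within {a..b})))"

definition piecewise_C1_curve ::
    "'a topology \<Rightarrow> ('a, 'b::euclidean_space) chart set \<Rightarrow> (real \<Rightarrow> 'a) \<Rightarrow> bool" where
  "piecewise_C1_curve X A \<gamma> \<longleftrightarrow>
     pathin X \<gamma> \<and>
     (\<exists>D. finite D \<and> {0, 1} \<subseteq> D \<and> D \<subseteq> {0..1} \<and>
          (\<forall>a\<in>D. \<forall>b\<in>D. a < b \<and> D \<inter> {a<..<b} = {} \<longrightarrow> C1_curve_on A \<gamma> a b))"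

text \<open>The integrand is insignificant at the finitely many break points and at \<open>0\<close> and \<open>1\<close>.\<close>

definition riemannian_length ::
    "('a, 'b::euclidean_space) chart set \<Rightarrow>
     ('a \<Rightarrow> ('a, 'b) tangent \<Rightarrow> ('a, 'b) tangent \<Rightarrow> real) \<Rightarrow> (real \<Rightarrow> 'a) \<Rightarrow> real" where
  "riemannian_length A g \<gamma> = integral {0..1} (\<lambda>t. tangent_norm g (\<gamma> t) (velocity A \<gamma> t))"

text \<open>
  The infimum is taken in the extended reals. It is \<open>\<infinity>\<close>, and then \<^const>\<open>real_of_ereal\<close> turns it
  into \<open>0\<close>, only if there is no curve from \<open>x\<close> to \<open>y\<close>; this does not happen for points of a
  connected manifold.
\<close>

definition riemannian_dist ::
    "'a topology \<Rightarrow> ('a, 'b::euclidean_space) chart set \<Rightarrow>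
     ('a \<Rightarrow> ('a, 'b) tangent \<Rightarrow> ('a, 'b) tangent \<Rightarrow> real) \<Rightarrow> 'a \<Rightarrow> 'a \<Rightarrow> real" where
  "riemannian_dist X A g x y =
     real_of_ereal (INF \<gamma>\<in>{\<gamma>. piecewise_C1_curve X A \<gamma> \<and> \<gamma> 0 = x \<and> \<gamma> 1 = y}.
       ereal (riemannian_length A g \<gamma>))"


section \<open>Riemannian isometric embeddings into Euclidean space\<close>

definition smooth_from_manifold ::
    "('a, 'b::euclidean_space) chart set \<Rightarrow> ('a \<Rightarrow> 'e::euclidean_space) \<Rightarrow> bool" where
  "smooth_from_manifold A \<phi> \<longleftrightarrow> (\<forall>c\<in>A. smooth_on (chart_img c) (\<phi> \<circ> chart_inv c))"

text \<open>
  Smoothness of a map from an arbitrary subset \<open>S\<close> of Euclidean space into a manifold: in charts,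
  it extends locally to a smooth map on an open set.
\<close>

definition smooth_into_manifold ::
    "('a, 'b::euclidean_space) chart set \<Rightarrow> 'e::euclidean_space set \<Rightarrow> ('e \<Rightarrow> 'a) \<Rightarrow> bool" where
  "smooth_into_manifold A S f \<longleftrightarrow>
     (\<forall>q\<in>S. \<forall>c\<in>A. f q \<in> chart_dom c \<longrightarrow>
        (\<exists>W F. open W \<and> q \<in> W \<and> f ` (S \<inter> W) \<subseteq> chart_dom c \<and> smooth_on W F \<and>
               (\<forall>x\<in>S \<inter> W. F x = chart_map c (f x))))"

definition diffeomorphism_onto_image ::
    "'a topology \<Rightarrow> ('a, 'b::euclidean_space) chart set \<Rightarrow> ('a \<Rightarrow> 'e::euclidean_space) \<Rightarrow> bool" where
  "diffeomorphism_onto_image X A \<phi> \<longleftrightarrow>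
     inj_on \<phi> (topspace X) \<and> smooth_from_manifold A \<phi> \<and>
     smooth_into_manifold A (\<phi> ` topspace X) (inv_into (topspace X) \<phi>)"

text \<open>The push-forward of \<open>V\<close>, computed in the chart \<open>c\<close>.\<close>

definition pushforward ::
    "('a, 'b::euclidean_space) chart \<Rightarrow> ('a \<Rightarrow> 'e::euclidean_space) \<Rightarrow> 'a \<Rightarrow> ('a, 'b) tangent \<Rightarrow> 'e" where
  "pushforward c \<phi> p V = frechet_derivative (\<phi> \<circ> chart_inv c) (at (chart_map c p)) (V c)"

definition riemannian_isometric_embedding ::
    "'a topology \<Rightarrow> ('a, 'b::euclidean_space) chart set \<Rightarrow>
     ('a \<Rightarrow> ('a, 'b) tangent \<Rightarrow> ('a, 'b) tangent \<Rightarrow> real) \<Rightarrow> ('a \<Rightarrow> 'e::euclidean_space) \<Rightarrow> bool" where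
  "riemannian_isometric_embedding X A g \<phi> \<longleftrightarrow>
     diffeomorphism_onto_image X A \<phi> \<and>
     (\<forall>p\<in>topspace X. \<forall>V\<in>tangent_space A p. \<forall>c\<in>A. p \<in> chart_dom c \<longrightarrow>
        norm (pushforward c \<phi> p V) = tangent_norm g p V)"


section \<open>Induced length metrics and metric isometric embeddings\<close>

text \<open>The supremum of the lengths of inscribed polygons.\<close>

definition curve_length :: "(real \<Rightarrow> 'z::metric_space) \<Rightarrow> ereal" where
  "curve_length \<gamma> =
     (SUP (n, t)\<in>{(n, t :: nat \<Rightarrow> real). t 0 = 0 \<and> t n = 1 \<and> (\<forall>i<n. t i \<le> t (Suc i))}.
        ereal (\<Sum>i<n. dist (\<gamma> (t i)) (\<gamma> (t (Suc i)))))"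

text \<open>
  Again the infimum is \<open>\<infinity>\<close>, and hence the value \<open>0\<close>, only if \<open>Y\<close> contains no rectifiable curve
  from \<open>y1\<close> to \<open>y2\<close>. For \<open>y1 \<noteq> y2\<close> in \<open>Y\<close> this violates the axiom \<open>d x y = 0 \<longleftrightarrow> x = y\<close>
  of \<^locale>\<open>Metric_space\<close>, so the latter can only hold if \<open>Y\<close> is rectifiably connected.
\<close>

definition induced_length_dist :: "'z::metric_space set \<Rightarrow> 'z \<Rightarrow> 'z \<Rightarrow> real" where
  "induced_length_dist Y y1 y2 =
     real_of_ereal (INF \<gamma>\<in>{\<gamma>. path \<gamma> \<and> path_image \<gamma> \<subseteq> Y \<and> pathstart \<gamma> = y1 \<and> pathfinish \<gamma> = y2}.
       curve_length \<gamma>)"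

definition metric_isometric_embedding ::
    "'x set \<Rightarrow> ('x \<Rightarrow> 'x \<Rightarrow> real) \<Rightarrow> 'z set \<Rightarrow> ('z \<Rightarrow> 'z \<Rightarrow> real) \<Rightarrow> ('x \<Rightarrow> 'z) \<Rightarrow> bool" where
  "metric_isometric_embedding X dX Z dZ \<phi> \<longleftrightarrow>
     Metric_space12 X dX Z dZ \<and> \<phi> \<in> X \<rightarrow> Z \<and>
     (\<forall>x1\<in>X. \<forall>x2\<in>X. dZ (\<phi> x1) (\<phi> x2) = dX x1 x2)"

end

theory Submission
  imports Defs
begin

text \<open>
  The nearest-point projection onto a nonempty closed convex set \<open>K\<close> is 1-Lipschitz; this is where
  convexity is used. It sends \<open>Z = closure (UNIV - K)\<close> into \<open>frontier K\<close> and fixes \<open>frontier K\<close>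
  pointwise. Hence a curve in \<open>Z\<close> between two points of \<open>frontier K\<close> can be replaced by its projection: the ends stay the same, the
  length does not grow, and the new curve runs in \<open>frontier K\<close>, the image of the manifold. So the
  exterior of \<open>K\<close> offers no shortcuts
  (\<open>closest_point_in_frontier\<close>, \<open>riemannian_dist_eq_induced_length_dist\<close>).

  It remains to compare two notions of length for curves in the surface: the metric length of an
  arbitrary continuous curve, and the integral of the speed of a piecewise continuously
  differentiable one.

  One direction is the fundamental theorem of calculus. Because the embedding is isometric, the
  speed of a curve \<open>\<gamma>\<close> in the manifold is the norm of the derivative of \<open>\<phi> \<circ> \<gamma>\<close> (\<open>speed_eq\<close>), so
  chords of \<open>\<phi> \<circ> \<gamma>\<close> are bounded by integrals of the speed, and the metric length of \<open>\<phi> \<circ> \<gamma>\<close> by the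
  Riemannian length of \<open>\<gamma>\<close> (\<open>curve_length_le_riemannian_length\<close>).

  For the other direction, the projected curve is merely continuous and has to be approximated.
  In a small coordinate ball the embedding is nearly equal to its derivative at the centre, which is
  injective; therefore the straight coordinate segment between two points is at most \<open>1 + e\<close> times
  as long as their chord in Euclidean space (\<open>embedding_almost_isometric_on_ball\<close>). By compactness
  a continuous curve in the surface can be cut into pieces that lie in such balls, and the chords
  of the pieces can be replaced by coordinate segments (\<open>polygonal_approximation\<close>). The resulting
  curve has Riemannian length at most \<open>1 + e\<close> times the length of an inscribed polygon.

  Both infima therefore agree. The length metric is finite, since any two points of the surface
  are joined by such a polygon of coordinate segments, and a point off the surface reaches it along
  the segment to its nearest point of \<open>K\<close>. The metric axioms hold for the length metric by reversing and
  concatenating curves, and they carry over to the Riemannian distance through the equality.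
\<close>

section \<open>Curve length and the induced length metric\<close>

lemma polygon_le_curve_length:
  assumes "t 0 = 0" "t n = 1" "\<And>i. i < n \<Longrightarrow> t i \<le> t (Suc i)"
  shows "ereal (\<Sum>i<n. dist (\<gamma> (t i)) (\<gamma> (t (Suc i)))) \<le> curve_length \<gamma>"
  unfolding curve_length_def by (rule SUP_upper2[where i = "(n, t)"]) (use assms in auto)

lemma curve_length_le:
  assumes "\<And>n t. \<lbrakk>t 0 = 0; t n = 1; \<And>i. i < n \<Longrightarrow> t i \<le> t (Suc i)\<rbrakk> \<Longrightarrow>
      ereal (\<Sum>i<n. dist (\<gamma> (t i)) (\<gamma> (t (Suc i)))) \<le> L"
  shows "curve_length \<gamma> \<le> L"
  unfolding curve_length_def by (rule SUP_least) (use assms in auto)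

lemma partition_in_unit_interval:
  fixes t :: "nat \<Rightarrow> real"
  assumes "t 0 = 0" "t n = 1" "\<And>i. i < n \<Longrightarrow> t i \<le> t (Suc i)" "i \<le> n"
  shows "t i \<in> {0..1}"
proof -
  have mono: "t i \<le> t j" if "i \<le> j" "j \<le> n" for i j
    using that by (induction j rule: dec_induct) (use assms(3) order_trans in force)+
  show ?thesis
    using mono[of 0 i] mono[of i n] assms by auto
qed

lemma dist_endpoints_le_curve_length: "ereal (dist (\<gamma> 0) (\<gamma> 1)) \<le> curve_length \<gamma>"
  using polygon_le_curve_length[of real 1 \<gamma>] by simp

lemma curve_length_nonneg: "0 \<le> curve_length \<gamma>"
  by (rule order_trans[OF _ dist_endpoints_le_curve_length]) simp

lemma curve_length_linepath: "curve_length (linepath a b) \<le> ereal (dist a b)"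
proof (rule curve_length_le)
  fix n and t :: "nat \<Rightarrow> real"
  assume t: "t 0 = 0" "t n = 1" "\<And>i. i < n \<Longrightarrow> t i \<le> t (Suc i)"
  have "dist (linepath a b (t i)) (linepath a b (t (Suc i))) = (t (Suc i) - t i) * dist a b"
    if "i < n" for i
  proof -
    have "linepath a b (t i) - linepath a b (t (Suc i)) = (t (Suc i) - t i) *\<^sub>R (a - b)"
      by (simp add: linepath_def algebra_simps)
    then show ?thesis
      using t(3)[OF that] by (simp add: dist_norm)
  qed
  then have "(\<Sum>i<n. dist (linepath a b (t i)) (linepath a b (t (Suc i)))) = dist a b"
    using t by (simp flip: sum_distrib_right add: sum_lessThan_telescope)
  then show "ereal (\<Sum>i<n. dist (linepath a b (t i)) (linepath a b (t (Suc i)))) \<le> ereal (dist a b)"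
    by simp
qed

lemma curve_length_reversepath_le: "curve_length (reversepath \<gamma>) \<le> curve_length \<gamma>"
proof (rule curve_length_le)
  fix n and t :: "nat \<Rightarrow> real"
  assume t: "t 0 = 0" "t n = 1" "\<And>i. i < n \<Longrightarrow> t i \<le> t (Suc i)"
  define s where "s i = 1 - t (n - i)" for i
  have s: "s i \<le> s (Suc i)" if "i < n" for i
    using t(3)[of "n - Suc i"] that unfolding s_def by (simp add: Suc_diff_Suc)
  have "(\<Sum>i<n. dist (reversepath \<gamma> (t i)) (reversepath \<gamma> (t (Suc i))))
      = (\<Sum>i<n. dist (\<gamma> (1 - t (n - Suc i))) (\<gamma> (1 - t (Suc (n - Suc i)))))"
    unfolding reversepath_def by (rule sum.nat_diff_reindex[symmetric])
  also have "\<dots> = (\<Sum>i<n. dist (\<gamma> (s i)) (\<gamma> (s (Suc i))))"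
    by (rule sum.cong) (auto simp: s_def Suc_diff_Suc dist_commute)
  finally show "ereal (\<Sum>i<n. dist (reversepath \<gamma> (t i)) (reversepath \<gamma> (t (Suc i))))
      \<le> curve_length \<gamma>"
    using polygon_le_curve_length[of s n \<gamma>] s t by (simp add: s_def)
qed

lemma curve_length_reversepath: "curve_length (reversepath \<gamma>) = curve_length \<gamma>"
  using curve_length_reversepath_le[of \<gamma>] curve_length_reversepath_le[of "reversepath \<gamma>"]
  by (simp add: order_antisym)

text \<open>
  A partition of the joined curve is doubled and cut off at the ends of the unit interval to give
  partitions of both parts; the one edge that straddles the junction is split there by the
  triangle inequality.
\<close>
lemma curve_length_joinpaths:
  assumes "pathfinish \<gamma> = pathstart \<delta>"
  shows "curve_length (\<gamma> +++ \<delta>) \<le> curve_length \<gamma> + curve_length \<delta>"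
proof (rule curve_length_le)
  fix n and t :: "nat \<Rightarrow> real"
  assume t: "t 0 = 0" "t n = 1" "\<And>i. i < n \<Longrightarrow> t i \<le> t (Suc i)"
  define r where "r i = min 1 (2 * t i)" for i
  define s where "s i = max 0 (2 * t i - 1)" for i
  have junction: "\<gamma> 1 = \<delta> 0"
    using assms by (simp add: pathfinish_def pathstart_def)
  have "dist ((\<gamma> +++ \<delta>) (t i)) ((\<gamma> +++ \<delta>) (t (Suc i)))
      \<le> dist (\<gamma> (r i)) (\<gamma> (r (Suc i))) + dist (\<delta> (s i)) (\<delta> (s (Suc i)))" if "i < n" for i
  proof -
    consider "t (Suc i) \<le> 1/2" | "t i \<le> 1/2" "1/2 < t (Suc i)" | "1/2 < t i"
      by linarith
    then show ?thesis
    proof cases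
      case 2
      then show ?thesis
        using dist_triangle[of "\<gamma> (2 * t i)" "\<delta> (2 * t (Suc i) - 1)" "\<gamma> 1"] junction
        by (simp add: joinpaths_def r_def s_def)
    qed (use t(3)[OF that] in \<open>simp_all add: joinpaths_def r_def s_def\<close>)
  qed
  then have "(\<Sum>i<n. dist ((\<gamma> +++ \<delta>) (t i)) ((\<gamma> +++ \<delta>) (t (Suc i))))
      \<le> (\<Sum>i<n. dist (\<gamma> (r i)) (\<gamma> (r (Suc i)))) + (\<Sum>i<n. dist (\<delta> (s i)) (\<delta> (s (Suc i))))"
    unfolding sum.distrib[symmetric] by (intro sum_mono) simp
  also have "ereal \<dots> \<le> curve_length \<gamma> + curve_length \<delta>"
    unfolding plus_ereal.simps(1)[symmetric]
    by (intro add_mono polygon_le_curve_length) (use t in \<open>fastforce simp: r_def s_def\<close>)+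
  finally show "ereal (\<Sum>i<n. dist ((\<gamma> +++ \<delta>) (t i)) ((\<gamma> +++ \<delta>) (t (Suc i))))
      \<le> curve_length \<gamma> + curve_length \<delta>"
    by simp
qed

abbreviation paths_in :: "'z::topological_space set \<Rightarrow> 'z \<Rightarrow> 'z \<Rightarrow> (real \<Rightarrow> 'z) set" where
  "paths_in Y y1 y2 \<equiv>
     {\<gamma>. path \<gamma> \<and> path_image \<gamma> \<subseteq> Y \<and> pathstart \<gamma> = y1 \<and> pathfinish \<gamma> = y2}"

definition rectifiably_joined :: "'z::metric_space set \<Rightarrow> 'z \<Rightarrow> 'z \<Rightarrow> bool" where
  "rectifiably_joined Y x y \<longleftrightarrow> (\<exists>\<gamma>\<in>paths_in Y x y. curve_length \<gamma> < \<infinity>)"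

lemma rectifiably_joined_sym:
  assumes "rectifiably_joined Y x y"
  shows "rectifiably_joined Y y x"
proof -
  obtain \<gamma> where "\<gamma> \<in> paths_in Y x y" "curve_length \<gamma> < \<infinity>"
    using assms by (auto simp: rectifiably_joined_def)
  then show ?thesis
    unfolding rectifiably_joined_def
    by (intro bexI[of _ "reversepath \<gamma>"]) (auto simp: curve_length_reversepath)
qed

lemma rectifiably_joined_trans:
  assumes "rectifiably_joined Y x y" "rectifiably_joined Y y z"
  shows "rectifiably_joined Y x z"
proof -
  obtain \<gamma> \<delta> where *: "\<gamma> \<in> paths_in Y x y" "curve_length \<gamma> < \<infinity>"
    "\<delta> \<in> paths_in Y y z" "curve_length \<delta> < \<infinity>"
    using assms by (auto simp: rectifiably_joined_def)
  then have "curve_length (\<gamma> +++ \<delta>) \<le> curve_length \<gamma> + curve_length \<delta>"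
    by (intro curve_length_joinpaths) auto
  also have "\<dots> < \<infinity>"
    using * by simp
  finally show ?thesis
    unfolding rectifiably_joined_def
    using * by (intro bexI[of _ "\<gamma> +++ \<delta>"]) (auto simp: path_image_join)
qed

lemma rectifiably_joined_linepath:
  fixes x y :: "'z::real_normed_vector"
  assumes "closed_segment x y \<subseteq> Y"
  shows "rectifiably_joined Y x y"
proof -
  have "curve_length (linepath x y) < \<infinity>"
    using curve_length_linepath[of x y] by (rule le_less_trans) simp
  then show ?thesis
    unfolding rectifiably_joined_def using assms by (intro bexI[of _ "linepath x y"]) auto
qed

lemma induced_length_INF_nonneg: "0 \<le> (INF \<gamma>\<in>paths_in Y x y. curve_length \<gamma>)"
  by (rule INF_greatest) (rule curve_length_nonneg)

lemma ereal_induced_length_dist: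
  assumes "rectifiably_joined Y x y"
  shows "ereal (induced_length_dist Y x y) = (INF \<gamma>\<in>paths_in Y x y. curve_length \<gamma>)"
proof -
  have "(INF \<gamma>\<in>paths_in Y x y. curve_length \<gamma>) < \<infinity>"
    using assms by (simp only: rectifiably_joined_def INF_less_iff)
  then show ?thesis
    unfolding induced_length_dist_def using induced_length_INF_nonneg[of Y x y]
    by (intro ereal_real') auto
qed

text \<open>
  Each axiom comes from an operation on curves: symmetry from reversal, the triangle
  inequality from concatenation. Separation holds because chords are shorter than curves.
\<close>
lemma Metric_space_induced_length_dist:
  fixes Y :: "'z::metric_space set"
  assumes joined: "\<And>x y. x \<in> Y \<Longrightarrow> y \<in> Y \<Longrightarrow> rectifiably_joined Y x y"
  shows "Metric_space Y (induced_length_dist Y)"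
proof
  fix x y :: 'z
  show "0 \<le> induced_length_dist Y x y"
    unfolding induced_length_dist_def
    using induced_length_INF_nonneg by (rule real_of_ereal_pos)
next
  have le: "(INF \<gamma>\<in>paths_in Y y x. curve_length \<gamma>) \<le> (INF \<gamma>\<in>paths_in Y x y. curve_length \<gamma>)"
    for x y
  proof (rule INF_greatest)
    fix \<gamma> assume "\<gamma> \<in> paths_in Y x y"
    then show "(INF \<gamma>\<in>paths_in Y y x. curve_length \<gamma>) \<le> curve_length \<gamma>"
      by (intro INF_lower2[of "reversepath \<gamma>"]) (auto simp: curve_length_reversepath)
  qed
  show "induced_length_dist Y x y = induced_length_dist Y y x" for x y
    unfolding induced_length_dist_def using order_antisym[OF le le] by simp
next
  fix x y assume xy: "x \<in> Y" "y \<in> Y"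
  have "ereal (dist x y) \<le> ereal (induced_length_dist Y x y)"
    unfolding ereal_induced_length_dist[OF joined[OF xy]]
  proof (rule INF_greatest)
    fix \<gamma> assume "\<gamma> \<in> paths_in Y x y"
    then show "ereal (dist x y) \<le> curve_length \<gamma>"
      using dist_endpoints_le_curve_length[of \<gamma>] by (auto simp: pathstart_def pathfinish_def)
  qed
  moreover have "ereal (induced_length_dist Y x x) \<le> ereal (dist x x)"
    unfolding ereal_induced_length_dist[OF joined[OF xy(1) xy(1)]]
  proof (rule INF_lower2)
    show "(\<lambda>_. x) \<in> paths_in Y x x"
      using xy by (auto simp: path_def path_image_def pathstart_def pathfinish_def)
    show "curve_length (\<lambda>_. x) \<le> ereal (dist x x)"
      by (rule curve_length_le) (simp add: zero_ereal_def)
  qed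
  moreover have "0 \<le> induced_length_dist Y x x"
    unfolding induced_length_dist_def using induced_length_INF_nonneg by (rule real_of_ereal_pos)
  ultimately show "induced_length_dist Y x y = 0 \<longleftrightarrow> x = y"
    by auto
next
  fix x y z assume xyz: "x \<in> Y" "y \<in> Y" "z \<in> Y"
  have near: "\<exists>\<gamma>\<in>paths_in Y x y. curve_length \<gamma> < ereal (induced_length_dist Y x y + e)"
    if "x \<in> Y" "y \<in> Y" "e > 0" for x y and e :: real
  proof -
    have "(INF \<gamma>\<in>paths_in Y x y. curve_length \<gamma>) < ereal (induced_length_dist Y x y + e)"
      unfolding ereal_induced_length_dist[OF joined[OF that(1,2)], symmetric] using that by simp
    then show ?thesis
      by (simp only: INF_less_iff)
  qed
  show "induced_length_dist Y x z \<le> induced_length_dist Y x y + induced_length_dist Y y z"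
  proof (rule field_le_epsilon)
    fix e :: real assume "e > 0"
    then have e: "e/2 > 0" by simp
    obtain \<gamma> where \<gamma>: "\<gamma> \<in> paths_in Y x y"
        "curve_length \<gamma> < ereal (induced_length_dist Y x y + e/2)"
      using near[OF xyz(1,2) e] by blast
    obtain \<delta> where \<delta>: "\<delta> \<in> paths_in Y y z"
        "curve_length \<delta> < ereal (induced_length_dist Y y z + e/2)"
      using near[OF xyz(2,3) e] by blast
    have "ereal (induced_length_dist Y x z) \<le> curve_length (\<gamma> +++ \<delta>)"
      unfolding ereal_induced_length_dist[OF joined[OF xyz(1,3)]]
      by (rule INF_lower) (use \<gamma> \<delta> in \<open>auto simp: path_image_join\<close>)
    also have "\<dots> \<le> curve_length \<gamma> + curve_length \<delta>"
      by (rule curve_length_joinpaths) (use \<gamma> \<delta> in auto)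
    also have "\<dots> \<le> ereal (induced_length_dist Y x y + e/2) + ereal (induced_length_dist Y y z + e/2)"
      using \<gamma> \<delta> by (intro add_mono) auto
    finally show "induced_length_dist Y x z
        \<le> induced_length_dist Y x y + induced_length_dist Y y z + e"
      by simp
  qed
qed

section \<open>The nearest-point projection onto a convex set\<close>

lemma exterior_closure: "closed K \<Longrightarrow> closure (UNIV - K) = (UNIV - K) \<union> frontier K"
  by (metis Compl_eq_Diff_UNIV closure_Un_frontier frontier_complement)

text \<open>
  If \<open>z\<close> lies off \<open>K\<close> and its nearest point were interior to \<open>K\<close>, moving that point a little towards \<open>z\<close> would stay in \<open>K\<close> and
  come closer to \<open>z\<close>.
\<close>
lemma closest_point_in_frontier:
  fixes K :: "'e::euclidean_space set"
  assumes "closed K" "K \<noteq> {}" "z \<in> closure (UNIV - K)"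
  shows "closest_point K z \<in> frontier K"
proof (cases "z \<in> K")
  case True
  then show ?thesis
    using assms exterior_closure[OF assms(1)] by (auto simp: closest_point_self)
next
  case False
  have "closest_point K z \<in> K"
    by (rule closest_point_in_set[OF assms(1,2)])
  moreover have "closest_point K z \<notin> interior K"
  proof
    assume "closest_point K z \<in> interior K"
    then obtain e where e: "e > 0" "ball (closest_point K z) e \<subseteq> K"
      by (meson mem_interior)
    define p where "p = closest_point K z"
    define s where "s = min 1 (e / (2 * dist z p))"
    have d: "dist z p > 0"
      using False \<open>closest_point K z \<in> K\<close> by (auto simp: p_def)
    then have s: "0 < s" "s \<le> 1" "s * dist z p < e"
      using e by (auto simp: s_def min_def field_simps)
    define w where "w = p + s *\<^sub>R (z - p)"
    have "dist p w = s * dist z p"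
      using s by (simp add: w_def dist_norm norm_minus_commute)
    then have "w \<in> K"
      using e s by (auto simp: p_def)
    then have "dist z p \<le> dist z w"
      unfolding p_def using closest_point_le[OF assms(1)] by blast
    moreover have "z - w = (1 - s) *\<^sub>R (z - p)"
      by (simp add: w_def algebra_simps)
    then have "dist z w = (1 - s) * dist z p"
      using s by (simp add: dist_norm)
    moreover have "s * dist z p > 0"
      using s d by simp
    ultimately show False
      by (simp add: algebra_simps)
  qed
  ultimately show ?thesis
    using assms by (simp add: frontier_def)
qed

text \<open>
  A point of \<open>K\<close> on the segment would be closer to \<open>z\<close> than the nearest point, unless it is the
  nearest point itself.
\<close>
lemma segment_to_closest_point:
  fixes K :: "'e::euclidean_space set"
  assumes "closed K" "K \<noteq> {}" "z \<in> closure (UNIV - K)"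
  shows "closed_segment z (closest_point K z) \<subseteq> closure (UNIV - K)"
proof
  fix w assume w: "w \<in> closed_segment z (closest_point K z)"
  show "w \<in> closure (UNIV - K)"
  proof (cases "w \<in> K")
    case True
    then have "dist z (closest_point K z) \<le> dist z w"
      by (rule closest_point_le[OF assms(1)])
    moreover have "dist z (closest_point K z) = dist z w + dist w (closest_point K z)"
      using w by (simp add: between_mem_segment[symmetric] between)
    ultimately have "w = closest_point K z"
      by simp
    then show ?thesis
      using closest_point_in_frontier[OF assms] exterior_closure[OF assms(1)] by auto
  qed (use exterior_closure[OF assms(1)] in auto)
qed

text \<open>
  For nonempty \<open>K\<close> every point of the exterior descends along a segment to the frontier, so only the
  frontier needs to be joined up; the exterior of the empty set is the whole space.
\<close>
lemma exterior_rectifiably_joined: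
  fixes K :: "'e::euclidean_space set"
  assumes "closed K"
    and frontier: "\<And>x y. x \<in> frontier K \<Longrightarrow> y \<in> frontier K \<Longrightarrow>
      rectifiably_joined (closure (UNIV - K)) x y"
    and "x \<in> closure (UNIV - K)" "y \<in> closure (UNIV - K)"
  shows "rectifiably_joined (closure (UNIV - K)) x y"
proof (cases "K = {}")
  case False
  have "rectifiably_joined (closure (UNIV - K)) z (closest_point K z)"
    if "z \<in> closure (UNIV - K)" for z
    using segment_to_closest_point[OF assms(1) False that] by (rule rectifiably_joined_linepath)
  then show ?thesis
    using frontier[of "closest_point K x" "closest_point K y"]
      closest_point_in_frontier[OF assms(1) False] assms(3,4)
    by (meson rectifiably_joined_sym rectifiably_joined_trans)
qed (simp add: rectifiably_joined_linepath)

section \<open>Derivatives of smooth maps\<close>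

lemma smooth_onD:
  assumes "smooth_on S f"
  shows smooth_on_differentiable: "x \<in> S \<Longrightarrow> f differentiable (at x)"
    and smooth_on_has_derivative: "x \<in> S \<Longrightarrow> (f has_derivative frechet_derivative f (at x)) (at x)"
    and smooth_on_continuous_on: "continuous_on S f"
    and smooth_on_continuous_derivative: "continuous_on S (\<lambda>x. frechet_derivative f (at x) v)"
proof -
  have "Ck_on (Suc 0) S f"
    using assms unfolding smooth_on_def by blast
  then have *: "\<forall>x\<in>S. f differentiable (at x)"
    and **: "\<forall>v. continuous_on S (\<lambda>x. frechet_derivative f (at x) v)"
    by auto
  show "x \<in> S \<Longrightarrow> f differentiable (at x)"
    using * by blast
  then show "x \<in> S \<Longrightarrow> (f has_derivative frechet_derivative f (at x)) (at x)"
    by (simp add: frechet_derivative_works[symmetric])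
  show "continuous_on S f"
    by (rule continuous_at_imp_continuous_on) (use * differentiable_imp_continuous_within in blast)
  show "continuous_on S (\<lambda>x. frechet_derivative f (at x) v)"
    using ** by blast
qed

lemma smooth_on_linear_derivative:
  assumes "smooth_on S f" "x \<in> S"
  shows "linear (frechet_derivative f (at x))"
  by (rule linear_frechet_derivative[OF smooth_on_differentiable[OF assms]])

text \<open>
  Expanding the direction in the standard basis reduces joint continuity to that of finitely many
  directional derivatives.
\<close>
lemma smooth_on_continuous_derivative_compose:
  fixes f :: "'b::euclidean_space \<Rightarrow> 'c::real_normed_vector"
  assumes f: "smooth_on S f"
    and x: "continuous_on T x" "x ` T \<subseteq> S" and v: "continuous_on T v"
  shows "continuous_on T (\<lambda>t. frechet_derivative f (at (x t)) (v t))"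
proof -
  have "frechet_derivative f (at (x t)) (v t)
      = (\<Sum>b\<in>Basis. (v t \<bullet> b) *\<^sub>R frechet_derivative f (at (x t)) b)" if "t \<in> T" for t
  proof -
    have lin: "linear (frechet_derivative f (at (x t)))"
      using smooth_on_linear_derivative[OF f] x(2) that by blast
    have "frechet_derivative f (at (x t)) (v t)
        = frechet_derivative f (at (x t)) (\<Sum>b\<in>Basis. (v t \<bullet> b) *\<^sub>R b)"
      by (simp add: euclidean_representation)
    also have "\<dots> = (\<Sum>b\<in>Basis. (v t \<bullet> b) *\<^sub>R frechet_derivative f (at (x t)) b)"
      by (simp add: linear_sum[OF lin] linear_scale[OF lin])
    finally show ?thesis .
  qed
  moreover have "continuous_on T (\<lambda>t. \<Sum>b\<in>Basis. (v t \<bullet> b) *\<^sub>R frechet_derivative f (at (x t)) b)"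
    by (intro continuous_intros v continuous_on_compose2[OF smooth_on_continuous_derivative[OF f] x])
  ultimately show ?thesis
    by (subst continuous_on_cong) auto
qed

text \<open>
  Continuity of the derivative as a linear map: the operator norm is controlled by the finitely
  many basis directions, each of which varies continuously.
\<close>
lemma smooth_on_derivative_near:
  fixes f :: "'b::euclidean_space \<Rightarrow> 'c::real_normed_vector"
  assumes f: "smooth_on S f" and S: "open S" "x0 \<in> S" and "\<delta> > 0"
  obtains r where "r > 0" "ball x0 r \<subseteq> S"
    "\<And>x v. x \<in> ball x0 r \<Longrightarrow>
      norm (frechet_derivative f (at x) v - frechet_derivative f (at x0) v) \<le> \<delta> * norm v"
proof -
  let ?D = "\<lambda>x. frechet_derivative f (at x)"
  define h where "h x = (\<Sum>b\<in>Basis. norm (?D x b - ?D x0 b))" for x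
  have "continuous_on S h"
    unfolding h_def by (intro continuous_intros smooth_on_continuous_derivative[OF f])
  then have "isCont h x0"
    using S continuous_on_eq_continuous_at by blast
  then obtain r1 where r1: "r1 > 0" "\<And>x. dist x x0 < r1 \<Longrightarrow> dist (h x) (h x0) < \<delta>"
    using \<open>\<delta> > 0\<close> unfolding continuous_at_eps_delta by blast
  obtain r2 where r2: "r2 > 0" "ball x0 r2 \<subseteq> S"
    using S openE by blast
  show ?thesis
  proof (rule that[of "min r1 r2"])
    show "ball x0 (min r1 r2) \<subseteq> S" "min r1 r2 > 0"
      using r1 r2 by auto
    fix x v assume x: "x \<in> ball x0 (min r1 r2)"
    then have "x \<in> S"
      using r2 by auto
    have "h x0 = 0"
      by (simp add: h_def)
    then have "h x < \<delta>"
      using r1(2)[of x] x by (auto simp: dist_commute dist_real_def)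
    have lin: "linear (\<lambda>v. ?D x v - ?D x0 v)"
      by (intro linear_compose_sub smooth_on_linear_derivative[OF f] \<open>x \<in> S\<close> S)
    have "?D x v - ?D x0 v = (\<lambda>v. ?D x v - ?D x0 v) (\<Sum>b\<in>Basis. (v \<bullet> b) *\<^sub>R b)"
      by (simp add: euclidean_representation)
    also have "\<dots> = (\<Sum>b\<in>Basis. (v \<bullet> b) *\<^sub>R (?D x b - ?D x0 b))"
      by (simp only: linear_sum[OF lin] linear_scale[OF lin])
    also have "norm \<dots> \<le> (\<Sum>b\<in>Basis. norm v * norm (?D x b - ?D x0 b))"
      by (rule sum_norm_le) (simp add: Basis_le_norm mult_right_mono)
    also have "\<dots> = norm v * h x"
      by (simp add: h_def sum_distrib_left)
    also have "\<dots> \<le> norm v * \<delta>"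
      using \<open>h x < \<delta>\<close> by (intro mult_left_mono) auto
    finally show "norm (?D x v - ?D x0 v) \<le> \<delta> * norm v"
      by (simp add: mult.commute)
  qed
qed

lemma vector_derivative_Icc:
  assumes "(f has_vector_derivative f') (at x within {a..b})" "a < b" "x \<in> {a..b}"
  shows "vector_derivative f (at x within {a..b}) = f'"
  using vector_derivative_within_cbox[of a b x f f'] assms by simp

section \<open>Charts and curves in an embedded manifold\<close>

locale embedded_manifold =
  fixes X :: "'a topology"
    and A :: "('a, 'b::euclidean_space) chart set"
    and g :: "'a \<Rightarrow> ('a, 'b) tangent \<Rightarrow> ('a, 'b) tangent \<Rightarrow> real"
    and \<phi> :: "'a \<Rightarrow> 'e::euclidean_space"
  assumes manifold: "smooth_manifold X A"
    and embedding: "riemannian_isometric_embedding X A g \<phi>"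
begin

abbreviation "surface \<equiv> \<phi> ` topspace X"

abbreviation "\<phi>inv \<equiv> inv_into (topspace X) \<phi>"

abbreviation speed :: "(real \<Rightarrow> 'a) \<Rightarrow> real \<Rightarrow> real" where
  "speed \<gamma> t \<equiv> tangent_norm g (\<gamma> t) (velocity A \<gamma> t)"

lemma charts_cover: "p \<in> topspace X \<Longrightarrow> \<exists>c\<in>A. p \<in> chart_dom c"
  using manifold unfolding smooth_manifold_def by blast

lemma
  assumes "c \<in> A"
  shows chart_dom_open: "openin X (chart_dom c)"
    and chart_img_open: "open (chart_img c)"
    and chart_homeomorphic:
      "homeomorphic_map (subtopology X (chart_dom c)) (top_of_set (chart_img c)) (chart_map c)"
  using manifold assms unfolding smooth_manifold_def by blast+

lemma chart_dom_subset: "c \<in> A \<Longrightarrow> chart_dom c \<subseteq> topspace X"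
  by (simp add: chart_dom_open openin_subset)

lemma topspace_chart: "c \<in> A \<Longrightarrow> topspace (subtopology X (chart_dom c)) = chart_dom c"
  by (simp add: Int_absorb1 chart_dom_subset)

lemma chart_inj: "c \<in> A \<Longrightarrow> inj_on (chart_map c) (chart_dom c)"
  using chart_homeomorphic homeomorphic_imp_injective_map topspace_chart by metis

lemma chart_inv_chart_map: "c \<in> A \<Longrightarrow> p \<in> chart_dom c \<Longrightarrow> chart_inv c (chart_map c p) = p"
  by (simp add: chart_inj)

lemma chart_inv_in_dom: "x \<in> chart_img c \<Longrightarrow> chart_inv c x \<in> chart_dom c"
  by (rule inv_into_into)

lemma chart_map_chart_inv: "x \<in> chart_img c \<Longrightarrow> chart_map c (chart_inv c x) = x"
  by (rule f_inv_into_f)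

lemma continuous_chart_map:
  "c \<in> A \<Longrightarrow> continuous_map (subtopology X (chart_dom c)) (top_of_set (chart_img c)) (chart_map c)"
  using chart_homeomorphic homeomorphic_imp_continuous_map by blast

lemma continuous_chart_inv:
  assumes "c \<in> A"
  shows "continuous_map (top_of_set (chart_img c)) X (chart_inv c)"
proof -
  obtain h where h: "homeomorphic_maps (subtopology X (chart_dom c)) (top_of_set (chart_img c)) (chart_map c) h"
    using chart_homeomorphic[OF assms] homeomorphic_map_maps by blast
  then have "continuous_map (top_of_set (chart_img c)) X h"
    and inv: "\<And>p. p \<in> chart_dom c \<Longrightarrow> h (chart_map c p) = p"
    using topspace_chart[OF assms]
    by (auto simp: homeomorphic_maps_def continuous_map_in_subtopology)
  moreover have "h x = chart_inv c x" if "x \<in> chart_img c" for x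
    using inv[OF chart_inv_in_dom[OF that]] chart_map_chart_inv[OF that] by simp
  ultimately show ?thesis
    by (auto intro: continuous_map_eq)
qed

lemma transition_smooth:
  assumes "c \<in> A" "c' \<in> A"
  shows "smooth_on (chart_map c ` (chart_dom c \<inter> chart_dom c')) (chart_map c' \<circ> chart_inv c)"
  using manifold assms unfolding smooth_manifold_def by blast

lemma embedding_smooth: "c \<in> A \<Longrightarrow> smooth_on (chart_img c) (\<phi> \<circ> chart_inv c)"
  using embedding
  unfolding riemannian_isometric_embedding_def diffeomorphism_onto_image_def smooth_from_manifold_def
  by blast

lemma embedding_inj: "inj_on \<phi> (topspace X)"
  using embedding
  unfolding riemannian_isometric_embedding_def diffeomorphism_onto_image_def by blast

lemma \<phi>inv_\<phi>: "p \<in> topspace X \<Longrightarrow> \<phi>inv (\<phi> p) = p"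
  by (simp add: embedding_inj)

lemma embedding_inverse_smooth:
  assumes "q \<in> surface" "c \<in> A" "\<phi>inv q \<in> chart_dom c"
  obtains W F where "open W" "q \<in> W" "\<phi>inv ` (surface \<inter> W) \<subseteq> chart_dom c" "smooth_on W F"
    "\<And>x. x \<in> surface \<inter> W \<Longrightarrow> F x = chart_map c (\<phi>inv x)"
proof -
  have "smooth_into_manifold A surface \<phi>inv"
    using embedding
    unfolding riemannian_isometric_embedding_def diffeomorphism_onto_image_def by blast
  from this[unfolded smooth_into_manifold_def, rule_format, OF assms] show ?thesis
    using that by metis
qed

lemma continuous_embedding: "continuous_map X euclidean \<phi>"
proof (rule pasting_lemma[where I = A and T = chart_dom and f = "\<lambda>_. \<phi>"])
  fix c assume c: "c \<in> A"
  show "openin X (chart_dom c)"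
    by (rule chart_dom_open[OF c])
  have "continuous_map (subtopology X (chart_dom c)) euclidean ((\<phi> \<circ> chart_inv c) \<circ> chart_map c)"
    by (rule continuous_map_compose[OF continuous_chart_map[OF c]])
      (use smooth_on_continuous_on[OF embedding_smooth[OF c]] in simp)
  then show "continuous_map (subtopology X (chart_dom c)) euclidean \<phi>"
    by (rule continuous_map_eq) (use chart_inv_chart_map[OF c] in auto)
qed (use charts_cover in \<open>blast+\<close>)

lemma curve_in_open_near:
  assumes "pathin X \<gamma>" "{a..b} \<subseteq> {0..1}" "openin X U" "t \<in> {a..b}" "\<gamma> t \<in> U"
  obtains d where "d > 0" "\<And>s. s \<in> {a..b} \<Longrightarrow> dist s t < d \<Longrightarrow> \<gamma> s \<in> U"
proof -
  have "openin (top_of_set {0..1}) {s \<in> topspace (top_of_set {0..1}). \<gamma> s \<in> U}"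
    using assms(1,3) unfolding pathin_def by (rule openin_continuous_map_preimage)
  then have "\<forall>t\<in>{s \<in> {0..1}. \<gamma> s \<in> U}. \<exists>d>0. \<forall>s\<in>{0..1}. dist s t < d \<longrightarrow> s \<in> {s \<in> {0..1}. \<gamma> s \<in> U}"
    unfolding topspace_euclidean_subtopology openin_euclidean_subtopology_iff by (rule conjunct2)
  moreover have "t \<in> {s \<in> {0..1}. \<gamma> s \<in> U}"
    using assms(2,4,5) by blast
  ultimately have "\<exists>d>0. \<forall>s\<in>{0..1}. dist s t < d \<longrightarrow> s \<in> {s \<in> {0..1}. \<gamma> s \<in> U}"
    by blast
  then obtain d where "d > 0" "\<forall>s\<in>{0..1}. dist s t < d \<longrightarrow> s \<in> {s \<in> {0..1}. \<gamma> s \<in> U}"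
    by blast
  then show ?thesis
    using assms(2) by (intro that[of d]) blast+
qed

text \<open>
  Near \<open>t\<close> the map \<open>h \<circ> \<gamma>\<close> factors through the chart \<open>c\<close>. This serves both for \<open>h = \<phi>\<close> and for
  \<open>h\<close> another chart.
\<close>
lemma curve_chain_rule:
  assumes c: "c \<in> A" "\<gamma> t \<in> chart_dom c" and "t \<in> I"
    and h: "(h \<circ> chart_inv c) differentiable (at (chart_map c (\<gamma> t)))"
    and v: "((chart_map c \<circ> \<gamma>) has_vector_derivative v) (at t within I)"
    and d: "d > 0" "\<And>s. s \<in> I \<Longrightarrow> dist s t < d \<Longrightarrow> \<gamma> s \<in> chart_dom c"
  shows "((h \<circ> \<gamma>) has_vector_derivative
      frechet_derivative (h \<circ> chart_inv c) (at (chart_map c (\<gamma> t))) v) (at t within I)"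
proof -
  have "((h \<circ> chart_inv c) has_derivative frechet_derivative (h \<circ> chart_inv c) (at (chart_map c (\<gamma> t))))
      (at ((chart_map c \<circ> \<gamma>) t) within (chart_map c \<circ> \<gamma>) ` I)"
    unfolding comp_apply[of "chart_map c" \<gamma>]
    by (rule has_derivative_at_withinI[OF h[unfolded frechet_derivative_works]])
  then have "((h \<circ> chart_inv c \<circ> (chart_map c \<circ> \<gamma>)) has_vector_derivative
      frechet_derivative (h \<circ> chart_inv c) (at (chart_map c (\<gamma> t))) v) (at t within I)"
    by (rule vector_derivative_diff_chain_within[OF v])
  then show ?thesis
    by (rule has_vector_derivative_transform_within[OF _ d(1) \<open>t \<in> I\<close>])
      (use d(2) chart_inv_chart_map[OF c(1)] in auto)
qed

context
  fixes \<gamma> a b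
  assumes curve: "pathin X \<gamma>" and ab: "0 \<le> a" "a < b" "b \<le> 1" and C1: "C1_curve_on A \<gamma> a b"
begin

lemma curve_in_topspace: "t \<in> {a..b} \<Longrightarrow> \<gamma> t \<in> topspace X"
  using curve ab unfolding pathin_def by (auto dest!: continuous_map_image_subset_topspace)

lemma chart_curve_derivative:
  assumes "c \<in> A" "t \<in> {a..b}" "\<gamma> t \<in> chart_dom c"
  shows "((chart_map c \<circ> \<gamma>) has_vector_derivative
      vector_derivative (chart_map c \<circ> \<gamma>) (at t within {a..b})) (at t within {a..b})"
  using C1 assms unfolding C1_curve_on_def vector_derivative_works by blast

lemma embedded_curve_derivative:
  assumes c: "c \<in> A" and t: "t \<in> {a..b}" and "\<gamma> t \<in> chart_dom c"
  shows "((\<phi> \<circ> \<gamma>) has_vector_derivative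
      frechet_derivative (\<phi> \<circ> chart_inv c) (at (chart_map c (\<gamma> t)))
        (vector_derivative (chart_map c \<circ> \<gamma>) (at t within {a..b}))) (at t within {a..b})"
proof -
  obtain d where "d > 0" "\<And>s. s \<in> {a..b} \<Longrightarrow> dist s t < d \<Longrightarrow> \<gamma> s \<in> chart_dom c"
    using curve_in_open_near[OF curve _ chart_dom_open[OF c] t assms(3)] ab by auto
  then show ?thesis
    using smooth_on_differentiable[OF embedding_smooth[OF c]] assms chart_curve_derivative[OF assms]
    by (intro curve_chain_rule) auto
qed

text \<open>
  Continuity up to the end points of the piece bounds the derivative there, which is what makes
  the speed integrable over all pieces.
\<close>
lemma embedded_curve_C1:
  "continuous_on {a..b} (\<lambda>t. vector_derivative (\<phi> \<circ> \<gamma>) (at t within {a..b}))"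
proof (unfold continuous_on_eq_continuous_within, rule ballI)
  fix t assume t: "t \<in> {a..b}"
  obtain c where c: "c \<in> A" "\<gamma> t \<in> chart_dom c"
    using charts_cover curve_in_topspace[OF t] by blast
  obtain d where d: "d > 0" "\<And>s. s \<in> {a..b} \<Longrightarrow> dist s t < d \<Longrightarrow> \<gamma> s \<in> chart_dom c"
    using curve_in_open_near[OF curve _ chart_dom_open[OF c(1)] t c(2)] ab by auto
  define T where "T = {s \<in> {a..b}. \<gamma> s \<in> chart_dom c}"
  have "continuous_on T (\<lambda>s. frechet_derivative (\<phi> \<circ> chart_inv c) (at ((chart_map c \<circ> \<gamma>) s))
        (vector_derivative (chart_map c \<circ> \<gamma>) (at s within {a..b})))"
  proof (rule smooth_on_continuous_derivative_compose[OF embedding_smooth[OF c(1)]])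
    show "continuous_on T (chart_map c \<circ> \<gamma>)"
      unfolding continuous_on_eq_continuous_within
    proof
      fix s assume "s \<in> T"
      then have "continuous (at s within {a..b}) (chart_map c \<circ> \<gamma>)"
        using chart_curve_derivative[OF c(1)] has_vector_derivative_continuous
        unfolding T_def by blast
      then show "continuous (at s within T) (chart_map c \<circ> \<gamma>)"
        by (rule continuous_within_subset) (auto simp: T_def)
    qed
    show "(chart_map c \<circ> \<gamma>) ` T \<subseteq> chart_img c"
      by (auto simp: T_def)
    show "continuous_on T (\<lambda>s. vector_derivative (chart_map c \<circ> \<gamma>) (at s within {a..b}))"
      using C1 c unfolding C1_curve_on_def T_def by blast
  qed
  moreover have "vector_derivative (\<phi> \<circ> \<gamma>) (at s within {a..b}) =
      frechet_derivative (\<phi> \<circ> chart_inv c) (at ((chart_map c \<circ> \<gamma>) s))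
        (vector_derivative (chart_map c \<circ> \<gamma>) (at s within {a..b}))" if "s \<in> T" for s
    using that embedded_curve_derivative[OF c(1)] ab
    by (intro vector_derivative_Icc) (auto simp: T_def)
  ultimately have "continuous_on T (\<lambda>s. vector_derivative (\<phi> \<circ> \<gamma>) (at s within {a..b}))"
    by (simp cong: continuous_on_cong)
  then have "continuous (at t within T) (\<lambda>s. vector_derivative (\<phi> \<circ> \<gamma>) (at s within {a..b}))"
    using t c by (auto simp: continuous_on_eq_continuous_within T_def)
  moreover have "at t within T = at t within {a..b}"
    by (rule at_within_nhd[of t "ball t d"]) (use d in \<open>auto simp: T_def dist_commute\<close>)
  ultimately show "continuous (at t within {a..b}) (\<lambda>s. vector_derivative (\<phi> \<circ> \<gamma>) (at s within {a..b}))"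
    by simp
qed

text \<open>
  The components of the velocity in two charts are related by the chain rule, so the velocity is
  a tangent vector and the isometry condition applies to it.
\<close>
lemma speed_eq:
  assumes t: "t \<in> {a<..<b}"
  shows "((\<phi> \<circ> \<gamma>) has_vector_derivative vector_derivative (\<phi> \<circ> \<gamma>) (at t within {a..b})) (at t)"
    and "speed \<gamma> t = norm (vector_derivative (\<phi> \<circ> \<gamma>) (at t))"
proof -
  have within: "at t within {a..b} = at t"
    using t by (simp add: at_within_Icc_at)
  have t': "t \<in> {a..b}"
    using t by simp
  have p: "\<gamma> t \<in> topspace X"
    by (rule curve_in_topspace[OF t'])
  obtain c where c: "c \<in> A" "\<gamma> t \<in> chart_dom c"
    using charts_cover p by blast
  have v: "velocity A \<gamma> t c' = vector_derivative (chart_map c' \<circ> \<gamma>) (at t within {a..b})"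
    if "c' \<in> A" "\<gamma> t \<in> chart_dom c'" for c'
    using that by (simp add: velocity_def within)
  have "velocity A \<gamma> t \<in> tangent_space A (\<gamma> t)"
    unfolding tangent_space_def
  proof (intro CollectI conjI allI ballI impI; (elim conjE)?)
    fix c assume "\<not> (c \<in> A \<and> \<gamma> t \<in> chart_dom c)"
    then show "velocity A \<gamma> t c = 0"
      unfolding velocity_def by (rule if_not_P)
  next
    fix c c' assume c: "c \<in> A" "\<gamma> t \<in> chart_dom c" and c': "c' \<in> A" "\<gamma> t \<in> chart_dom c'"
    obtain d where "d > 0" "\<And>s. s \<in> {a..b} \<Longrightarrow> dist s t < d \<Longrightarrow> \<gamma> s \<in> chart_dom c"
      using curve_in_open_near[OF curve _ chart_dom_open[OF c(1)] t' c(2)] ab by auto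
    moreover have "(chart_map c' \<circ> chart_inv c) differentiable (at (chart_map c (\<gamma> t)))"
      by (rule smooth_on_differentiable[OF transition_smooth[OF c(1) c'(1)]]) (use c c' in auto)
    ultimately have "((chart_map c' \<circ> \<gamma>) has_vector_derivative
        frechet_derivative (chart_map c' \<circ> chart_inv c) (at (chart_map c (\<gamma> t))) (velocity A \<gamma> t c))
        (at t within {a..b})"
      unfolding v[OF c] using chart_curve_derivative[OF c(1) t' c(2)] c t'
      by (intro curve_chain_rule) auto
    then show "velocity A \<gamma> t c' =
        frechet_derivative (chart_map c' \<circ> chart_inv c) (at (chart_map c (\<gamma> t))) (velocity A \<gamma> t c)"
      unfolding v[OF c'] within by (rule vector_derivative_at)
  qed
  then have "norm (pushforward c \<phi> (\<gamma> t) (velocity A \<gamma> t)) = speed \<gamma> t"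
    using embedding c p unfolding riemannian_isometric_embedding_def by blast
  moreover have push: "((\<phi> \<circ> \<gamma>) has_vector_derivative pushforward c \<phi> (\<gamma> t) (velocity A \<gamma> t)) (at t)"
    using embedded_curve_derivative[OF c(1) t' c(2)] unfolding pushforward_def v[OF c] within .
  ultimately show "speed \<gamma> t = norm (vector_derivative (\<phi> \<circ> \<gamma>) (at t))"
    by (simp add: vector_derivative_at)
  show "((\<phi> \<circ> \<gamma>) has_vector_derivative vector_derivative (\<phi> \<circ> \<gamma>) (at t within {a..b})) (at t)"
    using push unfolding within by (simp add: vector_derivative_at)
qed

end

end

section \<open>Riemannian length of piecewise continuously differentiable curves\<close>

lemma finite_set_gap:
  fixes D :: "real set"
  assumes "finite D" "a \<in> D" "b \<in> D" "t \<in> {a..b} - D"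
  obtains a' b' where "a' \<in> D" "b' \<in> D" "t \<in> {a'<..<b'}" "D \<inter> {a'<..<b'} = {}"
proof -
  let ?L = "{s \<in> D. s < t}" and ?R = "{s \<in> D. t < s}"
  have fin: "finite ?L" "finite ?R" and "a \<in> ?L" "b \<in> ?R"
    using assms by (auto simp: less_le)
  then have max: "Max ?L \<in> ?L" and min: "Min ?R \<in> ?R"
    using Max_in[OF fin(1)] Min_in[OF fin(2)] by blast+
  have "s \<le> Max ?L \<or> Min ?R \<le> s" if "s \<in> D" for s
  proof -
    have "s \<noteq> t"
      using that assms by blast
    then show ?thesis
      using that fin by (cases "s < t") (auto intro: Max_ge Min_le)
  qed
  then have "D \<inter> {Max ?L<..<Min ?R} = {}"
    by fastforce
  then show ?thesis
    using that[of "Max ?L" "Min ?R"] max min by auto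
qed

context embedded_manifold
begin

lemma path_embedded_curve:
  assumes "pathin X \<gamma>"
  shows "path (\<phi> \<circ> \<gamma>)" "path_image (\<phi> \<circ> \<gamma>) \<subseteq> surface"
proof -
  have "continuous_map (top_of_set {0..1}) euclidean (\<phi> \<circ> \<gamma>)"
    using assms continuous_embedding unfolding pathin_def by (rule continuous_map_compose)
  then show "path (\<phi> \<circ> \<gamma>)"
    by (simp add: path_def)
  have "\<gamma> ` {0..1} \<subseteq> topspace X"
    using continuous_map_image_subset_topspace[OF assms[unfolded pathin_def]] by simp
  then show "path_image (\<phi> \<circ> \<gamma>) \<subseteq> surface"
    unfolding path_image_def image_comp[symmetric] by (rule image_mono)
qed

text \<open>
  Off the break points the piecewise description yields ordinary two-sided derivatives of the
  embedded curve, with one bound for all the finitely many pieces.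
\<close>
lemma piecewise_C1_speed:
  assumes "piecewise_C1_curve X A \<gamma>"
  obtains D B where "finite D"
    "\<And>t. t \<in> {0..1} - D \<Longrightarrow>
      ((\<phi> \<circ> \<gamma>) has_vector_derivative vector_derivative (\<phi> \<circ> \<gamma>) (at t)) (at t)"
    "\<And>t. t \<in> {0..1} - D \<Longrightarrow> speed \<gamma> t = norm (vector_derivative (\<phi> \<circ> \<gamma>) (at t))"
    "\<And>t. t \<in> {0..1} - D \<Longrightarrow> norm (vector_derivative (\<phi> \<circ> \<gamma>) (at t)) \<le> B"
proof -
  obtain D where D: "pathin X \<gamma>" "finite D" "{0, 1} \<subseteq> D" "D \<subseteq> {0..1}"
    "\<forall>a\<in>D. \<forall>b\<in>D. a < b \<and> D \<inter> {a<..<b} = {} \<longrightarrow> C1_curve_on A \<gamma> a b"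
    using assms unfolding piecewise_C1_curve_def by (elim conjE exE) (rule that)
  define P where "P = {(a, b). a \<in> D \<and> b \<in> D \<and> a < b \<and> D \<inter> {a<..<b} = {}}"
  have P: "pathin X \<gamma>" "0 \<le> a" "a < b" "b \<le> 1" "C1_curve_on A \<gamma> a b" if "(a, b) \<in> P" for a b
    using that D unfolding P_def by auto
  have "finite P"
    by (rule finite_subset[of _ "D \<times> D"]) (use D in \<open>auto simp: P_def\<close>)
  moreover have "bounded ((\<lambda>t. vector_derivative (\<phi> \<circ> \<gamma>) (at t within {a..b})) ` {a..b})"
    if "(a, b) \<in> P" for a b
    by (intro compact_imp_bounded compact_continuous_image embedded_curve_C1[OF P[OF that]]
        compact_Icc)
  ultimately have "bounded (\<Union>(a, b)\<in>P. (\<lambda>t. vector_derivative (\<phi> \<circ> \<gamma>) (at t within {a..b})) ` {a..b})"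
    by (intro bounded_UN) auto
  then obtain B where "\<forall>y\<in>\<Union>(a, b)\<in>P. (\<lambda>t. vector_derivative (\<phi> \<circ> \<gamma>) (at t within {a..b})) ` {a..b}. norm y \<le> B"
    unfolding bounded_iff by (rule exE)
  then have B: "norm (vector_derivative (\<phi> \<circ> \<gamma>) (at t within {a..b})) \<le> B"
    if "(a, b) \<in> P" "t \<in> {a..b}" for a b t
    by (rule bspec) (rule UN_I[OF that(1)], simp only: case_prod_conv, rule imageI, rule that(2))
  have gap: "\<exists>a b. (a, b) \<in> P \<and> t \<in> {a<..<b}" if t: "t \<in> {0..1} - D" for t
  proof -
    have "0 \<in> D" "1 \<in> D"
      using D(3) by simp_all
    then obtain a b where ab: "a \<in> D" "b \<in> D" "t \<in> {a<..<b}" "D \<inter> {a<..<b} = {}"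
      using finite_set_gap[OF D(2) _ _ t] by metis
    then have "a < b"
      by simp
    then have "(a, b) \<in> P"
      using ab by (simp add: P_def)
    then show ?thesis
      using ab(3) by blast
  qed
  show ?thesis
  proof (rule that[OF D(2)])
    fix t assume "t \<in> {0..1} - D"
    then obtain a b where ab: "(a, b) \<in> P" "t \<in> {a<..<b}"
      using gap by blast
    note deriv = speed_eq[OF P[OF ab(1)] ab(2)]
    then have eq: "vector_derivative (\<phi> \<circ> \<gamma>) (at t) = vector_derivative (\<phi> \<circ> \<gamma>) (at t within {a..b})"
      by (simp add: vector_derivative_at)
    show "((\<phi> \<circ> \<gamma>) has_vector_derivative vector_derivative (\<phi> \<circ> \<gamma>) (at t)) (at t)"
      unfolding eq by (rule deriv(1))
    show "speed \<gamma> t = norm (vector_derivative (\<phi> \<circ> \<gamma>) (at t))"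
      by (rule deriv(2))
    show "norm (vector_derivative (\<phi> \<circ> \<gamma>) (at t)) \<le> B"
      unfolding eq using B[OF ab(1)] ab(2) by simp
  qed
qed

text \<open>
  The derivative of the embedded curve is integrable by the fundamental theorem of calculus; its
  norm, the speed, is then integrable because it is bounded.
\<close>
lemma
  assumes "piecewise_C1_curve X A \<gamma>"
  shows speed_integrable: "speed \<gamma> integrable_on {0..1}"
    and chord_le_integral_speed: "\<lbrakk>0 \<le> s; s \<le> t; t \<le> 1\<rbrakk> \<Longrightarrow>
      dist (\<phi> (\<gamma> s)) (\<phi> (\<gamma> t)) \<le> integral {s..t} (speed \<gamma>)"
proof -
  obtain D B where D: "finite D"
    "\<And>t. t \<in> {0..1} - D \<Longrightarrow>
      ((\<phi> \<circ> \<gamma>) has_vector_derivative vector_derivative (\<phi> \<circ> \<gamma>) (at t)) (at t)"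
    "\<And>t. t \<in> {0..1} - D \<Longrightarrow> speed \<gamma> t = norm (vector_derivative (\<phi> \<circ> \<gamma>) (at t))"
    "\<And>t. t \<in> {0..1} - D \<Longrightarrow> norm (vector_derivative (\<phi> \<circ> \<gamma>) (at t)) \<le> B"
    using piecewise_C1_speed[OF assms] by blast
  \<comment> \<open>At the break points the two-sided derivative need not exist; the value 0 there respects the bound.\<close>
  define v where "v t = (if t \<in> D then 0 else vector_derivative (\<phi> \<circ> \<gamma>) (at t))" for t
  have cont: "continuous_on {0..1} (\<phi> \<circ> \<gamma>)"
    using path_embedded_curve(1)[of \<gamma>] assms unfolding piecewise_C1_curve_def path_def by blast
  have ftc: "(v has_integral (\<phi> \<circ> \<gamma>) t - (\<phi> \<circ> \<gamma>) s) {s..t}" if "0 \<le> s" "s \<le> t" "t \<le> 1" for s t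
  proof (rule fundamental_theorem_of_calculus_interior_strong[OF D(1) that(2)])
    show "((\<phi> \<circ> \<gamma>) has_vector_derivative v x) (at x)" if x: "x \<in> {s<..<t} - D" for x
      using D(2)[of x] x \<open>0 \<le> s\<close> \<open>t \<le> 1\<close> by (simp add: v_def)
    show "continuous_on {s..t} (\<phi> \<circ> \<gamma>)"
      by (rule continuous_on_subset[OF cont]) (use that in auto)
  qed
  have "v absolutely_integrable_on {0..1}"
  proof (rule absolutely_integrable_integrable_bound)
    show "v integrable_on {0..1}"
      using ftc[of 0 1] by (auto simp: integrable_on_def)
    show "(\<lambda>_. \<bar>B\<bar>) integrable_on {0..1::real}"
      by (rule integrable_const_ivl)
    show "norm (v t) \<le> \<bar>B\<bar>" if "t \<in> {0..1}" for t
      using D(4)[of t] that by (auto simp: v_def)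
  qed
  then have norm_v: "(\<lambda>t. norm (v t)) integrable_on {0..1}"
    by (simp add: absolutely_integrable_on_def)
  have eq: "speed \<gamma> t = norm (v t)" if "t \<in> {0..1} - D" for t
    using D(3)[OF that] that by (simp add: v_def)
  show "speed \<gamma> integrable_on {0..1}"
    by (rule integrable_spike_finite[OF D(1) _ norm_v]) (rule eq)
  assume st: "0 \<le> s" "s \<le> t" "t \<le> 1"
  have "norm ((\<phi> \<circ> \<gamma>) t - (\<phi> \<circ> \<gamma>) s) = norm (integral {s..t} v)"
    using ftc[OF st] by (simp add: integral_unique)
  also have "\<dots> \<le> integral {s..t} (\<lambda>t. norm (v t))"
  proof (rule Henstock_Kurzweil_Integration.integral_norm_bound_integral)
    show "v integrable_on {s..t}"
      using ftc[OF st] by (auto simp: integrable_on_def)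
    show "(\<lambda>t. norm (v t)) integrable_on {s..t}"
      by (rule integrable_on_subinterval[OF norm_v]) (use st in auto)
  qed simp
  also have "\<dots> = integral {s..t} (speed \<gamma>)"
    by (rule integral_spike[OF negligible_finite[OF D(1)]]) (use eq st in auto)
  finally show "dist (\<phi> (\<gamma> s)) (\<phi> (\<gamma> t)) \<le> integral {s..t} (speed \<gamma>)"
    by (simp add: dist_norm norm_minus_commute)
qed

lemma curve_length_le_riemannian_length:
  assumes \<gamma>: "piecewise_C1_curve X A \<gamma>"
  shows "curve_length (\<phi> \<circ> \<gamma>) \<le> ereal (riemannian_length A g \<gamma>)"
proof (rule curve_length_le)
  fix n and t :: "nat \<Rightarrow> real"
  assume t: "t 0 = 0" "t n = 1" "\<And>i. i < n \<Longrightarrow> t i \<le> t (Suc i)"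
  have unit: "t i \<in> {0..1}" if "i \<le> n" for i
    by (rule partition_in_unit_interval[OF t that])
  have "(\<Sum>i<k. dist ((\<phi> \<circ> \<gamma>) (t i)) ((\<phi> \<circ> \<gamma>) (t (Suc i)))) \<le> integral {0..t k} (speed \<gamma>)"
    if "k \<le> n" for k
    using that
  proof (induction k)
    case (Suc k)
    have k: "0 \<le> t k" "t k \<le> t (Suc k)" "t (Suc k) \<le> 1"
      using unit[of k] unit[of "Suc k"] t(3)[of k] Suc.prems by auto
    have "integral {0..t k} (speed \<gamma>) + integral {t k..t (Suc k)} (speed \<gamma>) =
        integral {0..t (Suc k)} (speed \<gamma>)"
      by (rule Henstock_Kurzweil_Integration.integral_combine[OF k(1,2)])
        (rule integrable_on_subinterval[OF speed_integrable[OF \<gamma>]], use k in auto)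
    then show ?case
      using Suc chord_le_integral_speed[OF \<gamma> k] by simp
  qed (simp add: t)
  from this[of n] show "ereal (\<Sum>i<n. dist ((\<phi> \<circ> \<gamma>) (t i)) ((\<phi> \<circ> \<gamma>) (t (Suc i))))
      \<le> ereal (riemannian_length A g \<gamma>)"
    unfolding riemannian_length_def by (simp add: t)
qed

section \<open>Coordinate segments are almost as short as chords\<close>

text \<open>
  The smooth extension \<open>F\<close> of the coordinates on the surface is a left inverse of the embedding in
  coordinates, so its derivative is a left inverse of the derivative.
\<close>
lemma embedding_derivative_injective:
  assumes c: "c \<in> A" and x0: "x0 \<in> chart_img c"
  shows "inj (frechet_derivative (\<phi> \<circ> chart_inv c) (at x0))"
proof -
  let ?f = "\<phi> \<circ> chart_inv c"
  have in_X: "chart_inv c x \<in> topspace X" if "x \<in> chart_img c" for x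
    using chart_inv_in_dom[OF that] chart_dom_subset[OF c] by blast
  have inv: "\<phi>inv (?f x) = chart_inv c x" if "x \<in> chart_img c" for x
    using \<phi>inv_\<phi>[OF in_X[OF that]] by simp
  have "?f x0 \<in> surface" "\<phi>inv (?f x0) \<in> chart_dom c"
    using in_X[OF x0] inv[OF x0] chart_inv_in_dom[OF x0] by auto
  from embedding_inverse_smooth[OF this(1) c this(2)]
  obtain W F where W: "open W" "?f x0 \<in> W" "smooth_on W F"
    "\<And>y. y \<in> surface \<inter> W \<Longrightarrow> F y = chart_map c (\<phi>inv y)"
    by metis
  define N where "N = chart_img c \<inter> ?f -` W"
  have "open N"
    unfolding N_def
    by (rule continuous_open_preimage[OF smooth_on_continuous_on[OF embedding_smooth[OF c]]
          chart_img_open[OF c] W(1)])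
  have "x0 \<in> N"
    using x0 W by (simp add: N_def)
  have left_inv: "F (?f x) = x" if "x \<in> N" for x
  proof -
    have x: "x \<in> chart_img c" "?f x \<in> W"
      using that by (auto simp: N_def)
    then have "F (?f x) = chart_map c (\<phi>inv (?f x))"
      using in_X[OF x(1)] by (intro W(4)) auto
    then show ?thesis
      unfolding inv[OF x(1)] using chart_map_chart_inv[OF x(1)] by simp
  qed
  have "((F \<circ> ?f) has_derivative
      frechet_derivative F (at (?f x0)) \<circ> frechet_derivative ?f (at x0)) (at x0)"
    by (rule diff_chain_at[OF smooth_on_has_derivative[OF embedding_smooth[OF c] x0]
          smooth_on_has_derivative[OF W(3,2)]])
  moreover have "((F \<circ> ?f) has_derivative (\<lambda>v. v)) (at x0)"
    by (rule has_derivative_transform_within_open[OF has_derivative_ident \<open>open N\<close> \<open>x0 \<in> N\<close>])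
      (simp add: left_inv[simplified])
  ultimately have "frechet_derivative F (at (?f x0)) \<circ> frechet_derivative ?f (at x0) = (\<lambda>v. v)"
    by (rule has_derivative_unique)
  then show ?thesis
    by (intro inj_on_inverseI[of _ "frechet_derivative F (at (?f x0))"]) (metis comp_apply)
qed

text \<open>
  With \<open>k * norm v\<close> a lower bound for the derivative \<open>D\<close> at the centre, and derivatives in the ball
  within \<open>\<delta>\<close> of \<open>D\<close>, a tangent vector \<open>v = w - u\<close> has image of norm at most
  \<open>norm (D v) + \<delta> * norm v\<close>, while the chord has length at least \<open>norm (D v) - \<delta> * norm v\<close> by the
  mean value inequality. The ratio of the two tends to 1 as \<open>\<delta>\<close> tends
  to 0.
\<close>
lemma embedding_almost_isometric_on_ball:
  assumes c: "c \<in> A" and x0: "x0 \<in> chart_img c" and "e > 0"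
  obtains r where "r > 0" "ball x0 r \<subseteq> chart_img c"
    "\<And>u w x. \<lbrakk>u \<in> ball x0 r; w \<in> ball x0 r; x \<in> ball x0 r\<rbrakk> \<Longrightarrow>
      norm (frechet_derivative (\<phi> \<circ> chart_inv c) (at x) (w - u))
        \<le> (1 + e) * dist (\<phi> (chart_inv c u)) (\<phi> (chart_inv c w))"
proof -
  let ?f = "\<phi> \<circ> chart_inv c"
  let ?D = "\<lambda>x. frechet_derivative ?f (at x)"
  note smooth = embedding_smooth[OF c]
  obtain k where k: "k > 0" "\<And>v. k * norm v \<le> norm (?D x0 v)"
    using linear_inj_bounded_below_pos[OF smooth_on_linear_derivative[OF smooth x0]
        embedding_derivative_injective[OF c x0]] by blast
  \<comment> \<open>The solution of \<open>k + \<delta> = (1 + e) * (k - \<delta>)\<close>.\<close>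
  define \<delta> where "\<delta> = k * e / (2 + e)"
  have "\<delta> > 0"
    using k \<open>e > 0\<close> by (simp add: \<delta>_def)
  obtain r where r: "r > 0" "ball x0 r \<subseteq> chart_img c"
    "\<And>x v. x \<in> ball x0 r \<Longrightarrow> norm (?D x v - ?D x0 v) \<le> \<delta> * norm v"
    using smooth_on_derivative_near[OF smooth chart_img_open[OF c] x0 \<open>\<delta> > 0\<close>] by blast
  have chord: "norm (?f w - ?f u - ?D x0 (w - u)) \<le> \<delta> * norm (w - u)"
    if "u \<in> ball x0 r" "w \<in> ball x0 r" for u w
  proof -
    have lin: "linear (?D x0)"
      by (rule smooth_on_linear_derivative[OF smooth x0])
    have "norm ((\<lambda>x. ?f x - ?D x0 x) w - (\<lambda>x. ?f x - ?D x0 x) u) \<le> \<delta> * norm (w - u)"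
    proof (rule differentiable_bound[OF convex_ball _ _ that(2,1)])
      fix x assume x: "x \<in> ball x0 r"
      have "(?f has_derivative ?D x) (at x within ball x0 r)"
        using smooth_on_has_derivative[OF smooth] x r(2) has_derivative_at_withinI by blast
      then show "((\<lambda>x. ?f x - ?D x0 x) has_derivative (\<lambda>v. ?D x v - ?D x0 v)) (at x within ball x0 r)"
        by (intro has_derivative_diff linear_imp_has_derivative lin)
      show "onorm (\<lambda>v. ?D x v - ?D x0 v) \<le> \<delta>"
        by (rule onorm_le) (rule r(3)[OF x])
    qed
    moreover have "(\<lambda>x. ?f x - ?D x0 x) w - (\<lambda>x. ?f x - ?D x0 x) u = ?f w - ?f u - ?D x0 (w - u)"
      unfolding linear_diff[OF lin] by simp
    ultimately show ?thesis
      by (simp only:)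
  qed
  show ?thesis
  proof (rule that[OF r(1,2)])
    fix u w x assume *: "u \<in> ball x0 r" "w \<in> ball x0 r" "x \<in> ball x0 r"
    define v where "v = w - u"
    have "norm (?D x v) \<le> norm (?D x0 v) + \<delta> * norm v"
      using r(3)[OF *(3), of v] norm_triangle_sub[of "?D x v" "?D x0 v"] by linarith
    moreover have "norm (?D x0 v) - \<delta> * norm v \<le> dist (?f u) (?f w)"
      using chord[OF *(1,2)] norm_triangle_sub[of "?D x0 v" "?f w - ?f u"]
      by (simp add: v_def dist_norm norm_minus_commute)
    then have "(1 + e) * (norm (?D x0 v) - \<delta> * norm v) \<le> (1 + e) * dist (?f u) (?f w)"
      using \<open>e > 0\<close> by (intro mult_left_mono) auto
    moreover have "norm (?D x0 v) + \<delta> * norm v \<le> (1 + e) * (norm (?D x0 v) - \<delta> * norm v)"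
    proof -
      have "\<delta> * (2 + e) = k * e"
        using \<open>e > 0\<close> by (simp add: \<delta>_def)
      then have "\<delta> * norm v * (2 + e) = e * (k * norm v)"
        by (metis mult.assoc mult.commute)
      also have "\<dots> \<le> e * norm (?D x0 v)"
        using k(2)[of v] \<open>e > 0\<close> by (intro mult_left_mono) auto
      finally show ?thesis
        by (simp add: algebra_simps)
    qed
    ultimately show "norm (?D x (w - u)) \<le> (1 + e) * dist (\<phi> (chart_inv c u)) (\<phi> (chart_inv c w))"
      by (simp add: v_def)
  qed
qed

text \<open>
  Parametrized over the unit interval, the coordinate segment from \<open>u\<close> to \<open>w\<close> has speed, hence
  length, at most \<open>1 + e\<close> times the chord between its end points in Euclidean space.
\<close>
definition short_chart_segment :: "real \<Rightarrow> ('a, 'b) chart \<Rightarrow> 'b \<Rightarrow> 'b \<Rightarrow> bool" where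
  "short_chart_segment e c u w \<longleftrightarrow>
     c \<in> A \<and> closed_segment u w \<subseteq> chart_img c \<and>
     (\<forall>x\<in>closed_segment u w. norm (frechet_derivative (\<phi> \<circ> chart_inv c) (at x) (w - u))
        \<le> (1 + e) * dist (\<phi> (chart_inv c u)) (\<phi> (chart_inv c w)))"

text \<open>
  Closeness in Euclidean space forces closeness in coordinates, because the coordinates extend
  continuously to a Euclidean neighbourhood; so both points fall into a ball in which
  coordinate segments are short.
\<close>
lemma surface_short_chart_segments:
  assumes q: "q \<in> surface" and "e > 0"
  obtains r where "r > 0"
    "\<And>q1 q2. \<lbrakk>q1 \<in> surface \<inter> ball q r; q2 \<in> surface \<inter> ball q r\<rbrakk> \<Longrightarrow>
      \<exists>c u w. short_chart_segment e c u w \<and> chart_inv c u = \<phi>inv q1 \<and> chart_inv c w = \<phi>inv q2"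
proof -
  obtain c where c: "c \<in> A" "\<phi>inv q \<in> chart_dom c"
    using charts_cover inv_into_into[OF q] by blast
  obtain W F where W: "open W" "q \<in> W" "\<phi>inv ` (surface \<inter> W) \<subseteq> chart_dom c" "smooth_on W F"
    "\<And>x. x \<in> surface \<inter> W \<Longrightarrow> F x = chart_map c (\<phi>inv x)"
    using embedding_inverse_smooth[OF q c] by blast
  have Fq: "F q \<in> chart_img c"
    using W q c by auto
  obtain \<rho> where \<rho>: "\<rho> > 0" "ball (F q) \<rho> \<subseteq> chart_img c"
    "\<And>u w x. \<lbrakk>u \<in> ball (F q) \<rho>; w \<in> ball (F q) \<rho>; x \<in> ball (F q) \<rho>\<rbrakk> \<Longrightarrow>
      norm (frechet_derivative (\<phi> \<circ> chart_inv c) (at x) (w - u))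
        \<le> (1 + e) * dist (\<phi> (chart_inv c u)) (\<phi> (chart_inv c w))"
    using embedding_almost_isometric_on_ball[OF c(1) Fq \<open>e > 0\<close>] by blast
  have "open (W \<inter> F -` ball (F q) \<rho>)"
    by (rule continuous_open_preimage[OF smooth_on_continuous_on[OF W(4)] W(1) open_ball])
  moreover have "q \<in> W \<inter> F -` ball (F q) \<rho>"
    using W \<rho> by simp
  ultimately obtain r where r: "r > 0" "ball q r \<subseteq> W \<inter> F -` ball (F q) \<rho>"
    by (rule openE)
  show ?thesis
  proof (rule that[OF r(1)])
    fix q1 q2 assume q12: "q1 \<in> surface \<inter> ball q r" "q2 \<in> surface \<inter> ball q r"
    have F: "F q' \<in> ball (F q) \<rho>" "chart_inv c (F q') = \<phi>inv q'" if "q' \<in> surface \<inter> ball q r" for q'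
    proof -
      have "q' \<in> surface \<inter> W"
        using that r by blast
      then have "F q' = chart_map c (\<phi>inv q')" "\<phi>inv q' \<in> chart_dom c"
        using W by blast+
      then show "chart_inv c (F q') = \<phi>inv q'"
        using chart_inv_chart_map[OF c(1)] by simp
      show "F q' \<in> ball (F q) \<rho>"
        using that r by blast
    qed
    have "closed_segment (F q1) (F q2) \<subseteq> ball (F q) \<rho>"
      by (rule closed_segment_subset[OF F(1)[OF q12(1)] F(1)[OF q12(2)] convex_ball])
    then have "short_chart_segment e c (F q1) (F q2)"
      unfolding short_chart_segment_def using c(1) \<rho>(2,3) F(1)[OF q12(1)] F(1)[OF q12(2)] by blast
    then show "\<exists>c u w. short_chart_segment e c u w \<and> chart_inv c u = \<phi>inv q1 \<and> chart_inv c w = \<phi>inv q2"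
      using F(2)[OF q12(1)] F(2)[OF q12(2)] by blast
  qed
qed

end

section \<open>Polygonal approximation\<close>

lemma linepath_affine_has_vector_derivative:
  fixes a b :: real
  assumes "a < b"
  shows "((\<lambda>t. linepath u w ((t - a) / (b - a))) has_vector_derivative (1 / (b - a)) *\<^sub>R (w - u)) (at t within S)"
proof -
  have "((\<lambda>t. u + ((t - a) / (b - a)) *\<^sub>R (w - u)) has_vector_derivative (1 / (b - a)) *\<^sub>R (w - u)) (at t within S)"
    using assms by (auto intro!: derivative_eq_intros)
  then show ?thesis
    by (simp add: linepath_def algebra_simps)
qed

context embedded_manifold
begin

definition segment_curve :: "('a, 'b) chart \<Rightarrow> 'b \<Rightarrow> 'b \<Rightarrow> real \<Rightarrow> real \<Rightarrow> real \<Rightarrow> 'a" where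
  "segment_curve c u w a b t = chart_inv c (linepath u w ((t - a) / (b - a)))"

context
  fixes c :: "('a, 'b) chart" and u w :: 'b and a b :: real
  assumes c: "c \<in> A" and seg: "closed_segment u w \<subseteq> chart_img c" and ab: "a < b"
begin

lemma segment_coords: "t \<in> {a..b} \<Longrightarrow> linepath u w ((t - a) / (b - a)) \<in> closed_segment u w"
  using ab by (auto simp: linepath_image_01[symmetric] intro!: imageI)

lemma segment_curve_ends:
  shows "segment_curve c u w a b a = chart_inv c u" "segment_curve c u w a b b = chart_inv c w"
  using ab by (simp_all add: segment_curve_def linepath_def)

lemma segment_curve_continuous: "continuous_map (top_of_set {a..b}) X (segment_curve c u w a b)"
proof -
  have "continuous_on {a..b} (\<lambda>t. linepath u w ((t - a) / (b - a)))"
    by (rule continuous_on_vector_derivative) (rule linepath_affine_has_vector_derivative[OF ab])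
  then have "continuous_map (top_of_set {a..b}) (top_of_set (chart_img c)) (\<lambda>t. linepath u w ((t - a) / (b - a)))"
    using segment_coords seg by (auto simp: image_subset_iff subset_iff)
  then have "continuous_map (top_of_set {a..b}) X (chart_inv c \<circ> (\<lambda>t. linepath u w ((t - a) / (b - a))))"
    using continuous_chart_inv[OF c] by (rule continuous_map_compose)
  then show ?thesis
    by (simp add: o_def segment_curve_def[abs_def])
qed

lemma segment_curve_derivative:
  assumes h: "(h \<circ> chart_inv c) differentiable (at (linepath u w ((t - a) / (b - a))))"
  shows "((h \<circ> segment_curve c u w a b) has_vector_derivative
      frechet_derivative (h \<circ> chart_inv c) (at (linepath u w ((t - a) / (b - a))))
        ((1 / (b - a)) *\<^sub>R (w - u))) (at t within S)"
proof -
  have "((h \<circ> chart_inv c \<circ> (\<lambda>t. linepath u w ((t - a) / (b - a)))) has_vector_derivative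
      frechet_derivative (h \<circ> chart_inv c) (at (linepath u w ((t - a) / (b - a))))
        ((1 / (b - a)) *\<^sub>R (w - u))) (at t within S)"
    by (rule vector_derivative_diff_chain_within[OF linepath_affine_has_vector_derivative[OF ab]
          has_derivative_at_withinI[OF h[unfolded frechet_derivative_works]]])
  moreover have "h \<circ> segment_curve c u w a b = h \<circ> chart_inv c \<circ> (\<lambda>t. linepath u w ((t - a) / (b - a)))"
    by (simp add: fun_eq_iff segment_curve_def)
  ultimately show ?thesis
    by (simp only:)
qed

text \<open>
  In another chart the segment is the image of a line under a smooth coordinate change.
\<close>
lemma segment_curve_C1: "C1_curve_on A (segment_curve c u w a b) a b"
  unfolding C1_curve_on_def
proof (intro ballI conjI impI)
  let ?\<gamma> = "segment_curve c u w a b" and ?l = "\<lambda>t. linepath u w ((t - a) / (b - a))"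
  fix c' assume c': "c' \<in> A"
  let ?T = "{t \<in> {a..b}. ?\<gamma> t \<in> chart_dom c'}"
  note smooth = transition_smooth[OF c c']
  have coords: "?l t \<in> chart_map c ` (chart_dom c \<inter> chart_dom c')" if "t \<in> ?T" for t
  proof -
    have "?l t \<in> chart_img c"
      using segment_coords seg that by blast
    then have "chart_inv c (?l t) \<in> chart_dom c" "?l t = chart_map c (chart_inv c (?l t))"
      by (simp_all add: chart_inv_in_dom chart_map_chart_inv)
    moreover have "chart_inv c (?l t) \<in> chart_dom c'"
      using that by (simp add: segment_curve_def)
    ultimately show ?thesis
      by blast
  qed
  have deriv: "((chart_map c' \<circ> ?\<gamma>) has_vector_derivative
      frechet_derivative (chart_map c' \<circ> chart_inv c) (at (?l t)) ((1 / (b - a)) *\<^sub>R (w - u)))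
      (at t within {a..b})" if "t \<in> ?T" for t
    by (rule segment_curve_derivative[OF smooth_on_differentiable[OF smooth coords[OF that]]])
  {
    fix t assume "t \<in> {a..b}" "?\<gamma> t \<in> chart_dom c'"
    then have "t \<in> ?T"
      by blast
    from deriv[OF this] show "(chart_map c' \<circ> ?\<gamma>) differentiable (at t within {a..b})"
      by (rule differentiableI_vector)
  }
  have cont: "continuous_on ?T (\<lambda>t. frechet_derivative (chart_map c' \<circ> chart_inv c) (at (?l t)) ((1 / (b - a)) *\<^sub>R (w - u)))"
  proof (rule smooth_on_continuous_derivative_compose[OF smooth])
    show "continuous_on ?T ?l"
      by (rule continuous_on_vector_derivative) (rule linepath_affine_has_vector_derivative[OF ab])
    show "?l ` ?T \<subseteq> chart_map c ` (chart_dom c \<inter> chart_dom c')"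
      using coords by blast
  qed (rule continuous_on_const)
  have vd: "vector_derivative (chart_map c' \<circ> ?\<gamma>) (at t within {a..b}) =
      frechet_derivative (chart_map c' \<circ> chart_inv c) (at (?l t)) ((1 / (b - a)) *\<^sub>R (w - u))"
    if "t \<in> ?T" for t
    by (rule vector_derivative_Icc[OF deriv[OF that] ab]) (use that in blast)
  show "continuous_on ?T (\<lambda>t. vector_derivative (chart_map c' \<circ> ?\<gamma>) (at t within {a..b}))"
    by (rule iffD2[OF continuous_on_cong[OF refl vd] cont])
qed

end

lemma C1_curve_on_cong:
  assumes "C1_curve_on A f a b" and eq: "\<And>t. t \<in> {a..b} \<Longrightarrow> \<gamma> t = f t"
  shows "C1_curve_on A \<gamma> a b"
proof -
  have iff: "((chart_map c \<circ> \<gamma>) has_vector_derivative d) (at t within {a..b}) \<longleftrightarrow>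
      ((chart_map c \<circ> f) has_vector_derivative d) (at t within {a..b})"
    if "t \<in> {a..b}" for c :: "('a, 'b) chart" and t d
    using has_vector_derivative_transform[of t "{a..b}" "chart_map c \<circ> \<gamma>" "chart_map c \<circ> f" d]
      has_vector_derivative_transform[of t "{a..b}" "chart_map c \<circ> f" "chart_map c \<circ> \<gamma>" d] that eq
    by auto
  then have deriv: "vector_derivative (chart_map c \<circ> \<gamma>) (at t within {a..b}) =
      vector_derivative (chart_map c \<circ> f) (at t within {a..b})"
    if "t \<in> {a..b}" for c :: "('a, 'b) chart" and t
    using that by (simp add: vector_derivative_def)
  have diff: "(chart_map c \<circ> \<gamma>) differentiable (at t within {a..b}) \<longleftrightarrow>
      (chart_map c \<circ> f) differentiable (at t within {a..b})"
    if "t \<in> {a..b}" for c :: "('a, 'b) chart" and t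
    unfolding vector_derivative_works deriv[OF that] by (rule iff[OF that])
  have dom: "{t \<in> {a..b}. \<gamma> t \<in> chart_dom c} = {t \<in> {a..b}. f t \<in> chart_dom c}" for c :: "('a, 'b) chart"
    using eq by auto
  show ?thesis
    unfolding C1_curve_on_def dom
  proof (intro ballI conjI impI)
    fix c t assume "c \<in> A" "t \<in> {a..b}" "\<gamma> t \<in> chart_dom c"
    then have "f t \<in> chart_dom c"
      using eq by simp
    then have "(chart_map c \<circ> f) differentiable (at t within {a..b})"
      using assms(1)[unfolded C1_curve_on_def, rule_format, OF \<open>c \<in> A\<close>] \<open>t \<in> {a..b}\<close> by blast
    then show "(chart_map c \<circ> \<gamma>) differentiable (at t within {a..b})"
      unfolding diff[OF \<open>t \<in> {a..b}\<close>] .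
  next
    fix c assume "c \<in> A"
    have "continuous_on {t \<in> {a..b}. f t \<in> chart_dom c}
        (\<lambda>t. vector_derivative (chart_map c \<circ> f) (at t within {a..b}))"
      using assms(1)[unfolded C1_curve_on_def, rule_format, OF \<open>c \<in> A\<close>] by blast
    then show "continuous_on {t \<in> {a..b}. f t \<in> chart_dom c}
        (\<lambda>t. vector_derivative (chart_map c \<circ> \<gamma>) (at t within {a..b}))"
      by (rule iffD2[OF continuous_on_cong[OF refl], rotated]) (simp add: deriv)
  qed
qed

lemma segment_curve_speed:
  assumes short: "short_chart_segment e c u w"
    and curve: "pathin X \<gamma>" and ab: "0 \<le> a" "a < b" "b \<le> 1"
    and eq: "\<And>t. t \<in> {a..b} \<Longrightarrow> \<gamma> t = segment_curve c u w a b t" and t: "t \<in> {a<..<b}"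
  shows "speed \<gamma> t \<le> (1 + e) * dist (\<phi> (chart_inv c u)) (\<phi> (chart_inv c w)) / (b - a)"
proof -
  let ?x = "linepath u w ((t - a) / (b - a))"
  have c: "c \<in> A" and seg: "closed_segment u w \<subseteq> chart_img c"
    and bound: "\<And>x. x \<in> closed_segment u w \<Longrightarrow>
      norm (frechet_derivative (\<phi> \<circ> chart_inv c) (at x) (w - u))
        \<le> (1 + e) * dist (\<phi> (chart_inv c u)) (\<phi> (chart_inv c w))"
    using short unfolding short_chart_segment_def by blast+
  have x: "?x \<in> closed_segment u w"
    using segment_coords[OF c seg ab(2)] t by simp
  then have x': "?x \<in> chart_img c"
    using seg by blast
  have "((\<phi> \<circ> segment_curve c u w a b) has_vector_derivative
      frechet_derivative (\<phi> \<circ> chart_inv c) (at ?x) ((1 / (b - a)) *\<^sub>R (w - u))) (at t)"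
    by (rule segment_curve_derivative[OF c seg ab(2) smooth_on_differentiable[OF embedding_smooth[OF c] x']])
  then have "((\<phi> \<circ> \<gamma>) has_vector_derivative
      frechet_derivative (\<phi> \<circ> chart_inv c) (at ?x) ((1 / (b - a)) *\<^sub>R (w - u))) (at t)"
    by (rule has_vector_derivative_transform_within_open[where S = "{a<..<b}"]) (use t eq in auto)
  then have "speed \<gamma> t = norm (frechet_derivative (\<phi> \<circ> chart_inv c) (at ?x) ((1 / (b - a)) *\<^sub>R (w - u)))"
    using speed_eq(2)[OF curve ab C1_curve_on_cong[OF segment_curve_C1[OF c seg ab(2)] eq] t]
    by (simp add: vector_derivative_at)
  also have "\<dots> = norm (frechet_derivative (\<phi> \<circ> chart_inv c) (at ?x) (w - u)) / (b - a)"
    using ab by (simp add: linear_scale[OF smooth_on_linear_derivative[OF embedding_smooth[OF c] x']])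
  also have "\<dots> \<le> (1 + e) * dist (\<phi> (chart_inv c u)) (\<phi> (chart_inv c w)) / (b - a)"
    using bound[OF x] ab by (intro divide_right_mono) auto
  finally show ?thesis .
qed

text \<open>
  The unit interval is divided evenly and each part runs through one coordinate segment. On part
  \<open>i\<close> the speed is at most \<open>n\<close> times \<open>1 + e\<close> times the chord from \<open>q i\<close> to \<open>q (Suc i)\<close>, and the part has
  duration \<open>1 / n\<close>.
\<close>
lemma polygon_in_manifold:
  fixes q :: "nat \<Rightarrow> 'e"
  assumes "n > 0" and "e > 0"
    and q: "\<And>i. i \<le> n \<Longrightarrow> q i \<in> surface"
    and short: "\<And>i. i < n \<Longrightarrow> \<exists>c u w. short_chart_segment e c u w \<and>
      chart_inv c u = \<phi>inv (q i) \<and> chart_inv c w = \<phi>inv (q (Suc i))"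
  obtains \<gamma> where "piecewise_C1_curve X A \<gamma>" "\<gamma> 0 = \<phi>inv (q 0)" "\<gamma> 1 = \<phi>inv (q n)"
    "riemannian_length A g \<gamma> \<le> (1 + e) * (\<Sum>i<n. dist (q i) (q (Suc i)))"
proof -
  obtain c u w where short: "\<And>i. i < n \<Longrightarrow> short_chart_segment e (c i) (u i) (w i) \<and>
      chart_inv (c i) (u i) = \<phi>inv (q i) \<and> chart_inv (c i) (w i) = \<phi>inv (q (Suc i))"
    using short by metis
  define t where "t i = real i / real n" for i
  have t: "t 0 = 0" "t n = 1" "\<And>i j. t i < t j \<longleftrightarrow> i < j" "\<And>i j. t i \<le> t j \<longleftrightarrow> i \<le> j"
    "\<And>i. 0 \<le> t i" "\<And>i. t i \<le> 1 \<longleftrightarrow> i \<le> n"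
    using \<open>n > 0\<close> by (auto simp: t_def divide_simps)
  define f where "f i = segment_curve (c i) (u i) (w i) (t i) (t (Suc i))" for i
  have c: "c i \<in> A" "closed_segment (u i) (w i) \<subseteq> chart_img (c i)" if "i < n" for i
    using short[OF that] unfolding short_chart_segment_def by blast+
  have t_Suc: "t i < t (Suc i)" for i
    by (simp add: t)
  have ends: "f i (t i) = \<phi>inv (q i)" "f i (t (Suc i)) = \<phi>inv (q (Suc i))" if "i < n" for i
    unfolding f_def segment_curve_ends[OF c[OF that] t_Suc] using short[OF that] by blast+
  \<comment> \<open>Different parts overlap only at a common vertex, where the pieces agree.\<close>
  have meet: "f i x = f j x"
    if "i < j" "j < n" "x \<in> {t i..t (Suc i)}" "x \<in> {t j..t (Suc j)}" for i j x
  proof -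
    have "t j \<le> t (Suc i)"
      using that(3,4) by simp
    then have "j = Suc i"
      using that(1) by (simp add: t)
    then have "x = t (Suc i)"
      using that(3,4) by simp
    then show ?thesis
      using ends[of i] ends[of j] that(1,2) \<open>j = Suc i\<close> by simp
  qed
  have cover: "\<exists>i<n. x \<in> {t i..t (Suc i)}" if "x \<in> {0..1}" for x
  proof (cases "x = 1")
    case True
    then show ?thesis
      using \<open>n > 0\<close> t(2) t_Suc[of "n - 1"] by (intro exI[of _ "n - 1"]) auto
  next
    case False
    have "x * real n < real n"
      using False that \<open>n > 0\<close> by simp
    then have "nat \<lfloor>x * real n\<rfloor> < n"
      using that by (simp add: nat_less_iff floor_less_iff)
    moreover have "x \<in> {t (nat \<lfloor>x * real n\<rfloor>)..t (Suc (nat \<lfloor>x * real n\<rfloor>))}"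
      using that \<open>n > 0\<close> by (simp add: t_def divide_simps) linarith
    ultimately show ?thesis
      by blast
  qed
  obtain \<gamma> where \<gamma>: "continuous_map (top_of_set {0..1}) X \<gamma>"
    "\<And>i x. i < n \<Longrightarrow> x \<in> {t i..t (Suc i)} \<Longrightarrow> \<gamma> x = f i x"
  proof (rule pasting_lemma_exists_closed[of "{..<n}" "top_of_set {0..1::real}" "\<lambda>i. {t i..t (Suc i)}" X f])
    show "topspace (top_of_set {0..1::real}) \<subseteq> (\<Union>i\<in>{..<n}. {t i..t (Suc i)})"
      using cover by fastforce
    fix i assume i: "i \<in> {..<n}"
    have sub: "{t i..t (Suc i)} \<subseteq> {0..1}"
      using i t(5)[of i] t(6)[of "Suc i"] by auto
    then show "closedin (top_of_set {0..1}) {t i..t (Suc i)}"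
      by (simp add: closed_subset)
    have "continuous_map (top_of_set {t i..t (Suc i)}) X (f i)"
      unfolding f_def by (rule segment_curve_continuous[OF c t_Suc]) (use i in auto)
    moreover have "{0..1} \<inter> {t i..t (Suc i)} = {t i..t (Suc i)}"
      using sub by blast
    ultimately show "continuous_map (subtopology (top_of_set {0..1}) {t i..t (Suc i)}) X (f i)"
      by (simp only: subtopology_subtopology)
  next
    fix i j x assume "i \<in> {..<n}" "j \<in> {..<n}"
      "x \<in> topspace (top_of_set {0..1}) \<inter> {t i..t (Suc i)} \<inter> {t j..t (Suc j)}"
    then have "i < n" "j < n" "x \<in> {t i..t (Suc i)}" "x \<in> {t j..t (Suc j)}"
      by simp_all
    then show "f i x = f j x"
      using meet[of i j x] meet[of j i x] by (metis linorder_neqE_nat)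
  next
    fix \<gamma> assume *: "continuous_map (top_of_set {0..1}) X \<gamma>"
      "\<And>x i. \<lbrakk>i \<in> {..<n}; x \<in> topspace (top_of_set {0..1}) \<inter> {t i..t (Suc i)}\<rbrakk> \<Longrightarrow> \<gamma> x = f i x"
    have "\<gamma> x = f i x" if "i < n" "x \<in> {t i..t (Suc i)}" for i x
      using that t(5)[of i] t(6)[of "Suc i"] by (intro *(2)) auto
    then show thesis
      using that[OF *(1)] by blast
  qed simp
  have \<gamma>_path: "pathin X \<gamma>"
    using \<gamma>(1) by (simp add: pathin_def)
  have \<gamma>_ends: "\<gamma> 0 = \<phi>inv (q 0)" "\<gamma> 1 = \<phi>inv (q n)"
    using \<gamma>(2)[of 0 "t 0"] \<gamma>(2)[of "n - 1" "t n"] ends[of 0] ends[of "n - 1"] \<open>n > 0\<close> t_Suc[of 0] t_Suc[of "n - 1"]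
    by (simp_all add: t)
  have piecewise: "piecewise_C1_curve X A \<gamma>"
    unfolding piecewise_C1_curve_def
  proof (intro conjI exI[of _ "t ` {..n}"] ballI impI; (elim conjE)?)
    show "{0, 1} \<subseteq> t ` {..n}"
      using t(1,2) by (metis atMost_iff empty_subsetI image_eqI insert_subset le0 order_refl)
    show "t ` {..n} \<subseteq> {0..1}"
      by (auto simp: t)
    fix a b assume "a \<in> t ` {..n}" "b \<in> t ` {..n}" "a < b" and gap: "t ` {..n} \<inter> {a<..<b} = {}"
    then obtain i j where ij: "a = t i" "b = t j" "i < j" "j \<le> n"
      by (auto simp: t)
    have "t (Suc i) \<in> t ` {..n}"
      using ij by simp
    then have "t (Suc i) \<notin> {a<..<b}"
      using gap by blast
    then have "j = Suc i"
      using ij by (simp add: t)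
    then have i: "i < n" "a = t i" "b = t (Suc i)"
      using ij by auto
    show "C1_curve_on A \<gamma> a b"
      unfolding i(2,3)
    proof (rule C1_curve_on_cong)
      show "C1_curve_on A (f i) (t i) (t (Suc i))"
        unfolding f_def by (rule segment_curve_C1[OF c[OF i(1)] t_Suc])
    qed (rule \<gamma>(2)[OF i(1)])
  qed (use \<gamma>_path in auto)
  have "integral {0..t k} (speed \<gamma>) \<le> (\<Sum>i<k. (1 + e) * dist (q i) (q (Suc i)))" if "k \<le> n" for k
    using that
  proof (induction k)
    case (Suc k)
    let ?a = "t k" and ?b = "t (Suc k)"
    define M where "M = (1 + e) * dist (q k) (q (Suc k))"
    have k: "k < n" "0 \<le> ?a" "?a < ?b" "?b \<le> 1"
      using Suc.prems by (simp_all add: t)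
    have integrable: "speed \<gamma> integrable_on {x..y}" if "0 \<le> x" "y \<le> 1" for x y
      by (rule integrable_on_subinterval[OF speed_integrable[OF piecewise]]) (use that in auto)
    have M: "M \<ge> 0"
      using \<open>e > 0\<close> by (simp add: M_def)
    have at_ends: "\<phi> (chart_inv (c k) (u k)) = q k" "\<phi> (chart_inv (c k) (w k)) = q (Suc k)"
      using short[OF k(1)] q[of k] q[of "Suc k"] k(1) by (simp_all add: f_inv_into_f)
    have speed: "speed \<gamma> s \<le> M / (?b - ?a)" if "s \<in> {?a<..<?b}" for s
      using segment_curve_speed[OF conjunct1[OF short[OF k(1)]] \<gamma>_path k(2-4) \<gamma>(2)[OF k(1), unfolded f_def] that]
      unfolding at_ends M_def .
    \<comment> \<open>The speed bound holds only between the vertices, where the two-sided velocity exists.\<close>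
    let ?s = "\<lambda>s. if s \<in> {?a, ?b} then 0 else speed \<gamma> s"
    have "integral {?a..?b} (speed \<gamma>) = integral {?a..?b} ?s"
      by (rule integral_spike[OF negligible_finite[of "{?a, ?b}"]]) auto
    also have "\<dots> \<le> integral {?a..?b} (\<lambda>_. M / (?b - ?a))"
    proof (rule Henstock_Kurzweil_Integration.integral_le)
      show "?s integrable_on {?a..?b}"
        by (rule integrable_spike_finite[of "{?a, ?b}", OF _ _ integrable]) (use k in auto)
      show "?s s \<le> M / (?b - ?a)" if "s \<in> {?a..?b}" for s
        using speed[of s] that M k(3) by auto
    qed (rule integrable_const_ivl)
    also have "\<dots> = M"
      using k(3) by simp
    finally have "integral {?a..?b} (speed \<gamma>) \<le> M" .
    moreover have "integral {0..?a} (speed \<gamma>) + integral {?a..?b} (speed \<gamma>) = integral {0..?b} (speed \<gamma>)"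
      by (rule Henstock_Kurzweil_Integration.integral_combine[OF k(2) less_imp_le[OF k(3)] integrable])
        (use k in auto)
    ultimately show ?case
      using Suc by (simp add: M_def)
  qed (simp add: t)
  from this[of n] have "riemannian_length A g \<gamma> \<le> (1 + e) * (\<Sum>i<n. dist (q i) (q (Suc i)))"
    unfolding riemannian_length_def by (simp add: t sum_distrib_left)
  then show ?thesis
    using that piecewise \<gamma>_ends by blast
qed

text \<open>
  Compactness of the curve gives one radius that works along all of it, and uniform continuity a
  partition whose consecutive points are that close.
\<close>
lemma polygonal_approximation:
  assumes \<eta>: "path \<eta>" "path_image \<eta> \<subseteq> surface" and "e > 0"
  obtains \<gamma> n t where "piecewise_C1_curve X A \<gamma>" "\<gamma> 0 = \<phi>inv (\<eta> 0)" "\<gamma> 1 = \<phi>inv (\<eta> 1)"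
    "t 0 = 0" "t n = 1" "\<forall>i<n. t i \<le> t (Suc i)"
    "riemannian_length A g \<gamma> \<le> (1 + e) * (\<Sum>i<n. dist (\<eta> (t i)) (\<eta> (t (Suc i))))"
proof -
  define good where "good G \<longleftrightarrow> open G \<and> (\<forall>q1\<in>surface \<inter> G. \<forall>q2\<in>surface \<inter> G.
      \<exists>c u w. short_chart_segment e c u w \<and> chart_inv c u = \<phi>inv q1 \<and> chart_inv c w = \<phi>inv q2)"
    for G
  have "\<exists>G\<in>Collect good. q \<in> G" if "q \<in> path_image \<eta>" for q
  proof -
    have "q \<in> surface"
      using that \<eta> by blast
    then obtain r where "r > 0" "good (ball q r)"
      using surface_short_chart_segments[OF _ \<open>e > 0\<close>] unfolding good_def by (metis open_ball)
    then show ?thesis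
      by (intro bexI[of _ "ball q r"]) simp_all
  qed
  then have cover: "path_image \<eta> \<subseteq> \<Union>(Collect good)"
    by blast
  have ope: "open G" if "G \<in> Collect good" for G
    using that by (simp add: good_def)
  obtain \<epsilon> where \<epsilon>: "\<epsilon> > 0" "\<And>q. q \<in> path_image \<eta> \<Longrightarrow> \<exists>G\<in>Collect good. ball q \<epsilon> \<subseteq> G"
    by (rule Heine_Borel_lemma[OF compact_path_image[OF \<eta>(1)] cover])
      (rule ope, assumption, rule that, assumption, blast)
  have "uniformly_continuous_on {0..1} \<eta>"
    using \<eta>(1) unfolding path_def by (intro compact_uniformly_continuous) auto
  then obtain d where d: "d > 0"
    "\<And>s s'. \<lbrakk>s \<in> {0..1}; s' \<in> {0..1}; dist s' s < d\<rbrakk> \<Longrightarrow> dist (\<eta> s') (\<eta> s) < \<epsilon>"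
    using \<epsilon>(1) unfolding uniformly_continuous_on_def by metis
  obtain n where n: "n > 0" "1 / real n < d"
    using reals_Archimedean[OF d(1)] by (metis inverse_eq_divide zero_less_Suc)
  define t where "t i = real i / real n" for i
  have t: "t 0 = 0" "t n = 1" "\<And>i. t i \<le> t (Suc i)" "\<And>i. i \<le> n \<Longrightarrow> t i \<in> {0..1}"
    "\<And>i. dist (t (Suc i)) (t i) < d"
    using n by (auto simp: t_def divide_simps dist_real_def diff_divide_distrib[symmetric])
  have on_surface: "\<eta> (t i) \<in> surface" if "i \<le> n" for i
    using t(4)[OF that] \<eta>(2) unfolding path_image_def by blast
  have "\<exists>c u w. short_chart_segment e c u w \<and>
      chart_inv c u = \<phi>inv (\<eta> (t i)) \<and> chart_inv c w = \<phi>inv (\<eta> (t (Suc i)))" if "i < n" for i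
  proof -
    have i: "t i \<in> {0..1}" "t (Suc i) \<in> {0..1}"
      using t(4) that by auto
    then obtain G where G: "good G" "ball (\<eta> (t i)) \<epsilon> \<subseteq> G"
      using \<epsilon>(2)[of "\<eta> (t i)"] unfolding path_image_def by blast
    have "\<eta> (t i) \<in> G" "\<eta> (t (Suc i)) \<in> G"
      using G(2) \<epsilon>(1) d(2)[OF i t(5)] by (auto simp: dist_commute subset_iff)
    then show ?thesis
      using G(1) on_surface[of i] on_surface[of "Suc i"] that unfolding good_def by simp
  qed
  from polygon_in_manifold[of n e "\<lambda>i. \<eta> (t i)", OF n(1) \<open>e > 0\<close> on_surface this]
  obtain \<gamma> where "piecewise_C1_curve X A \<gamma>" "\<gamma> 0 = \<phi>inv (\<eta> (t 0))" "\<gamma> 1 = \<phi>inv (\<eta> (t n))"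
    "riemannian_length A g \<gamma> \<le> (1 + e) * (\<Sum>i<n. dist (\<eta> (t i)) (\<eta> (t (Suc i))))"
    by blast
  then show ?thesis
    using that[of \<gamma> t n] t(1-3) by simp
qed

text \<open>
  Nearby points are joined by coordinate segments, so path components are open in the surface.
\<close>
lemma surface_path_connected:
  assumes "connected_space X" "q \<in> surface" "q' \<in> surface"
  shows "path_component surface q q'"
proof (rule connected_equivalence_relation[OF _ assms(2,3), where R = "path_component surface"])
  show "connected surface"
    using connectedin_continuous_map_image[OF continuous_embedding, of "topspace X"] assms(1)
    by (simp add: connectedin_topspace)
  fix q assume q: "q \<in> surface"
  obtain r where r: "r > 0" "\<And>q1 q2. \<lbrakk>q1 \<in> surface \<inter> ball q r; q2 \<in> surface \<inter> ball q r\<rbrakk> \<Longrightarrow>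
      \<exists>c u w. short_chart_segment 1 c u w \<and> chart_inv c u = \<phi>inv q1 \<and> chart_inv c w = \<phi>inv q2"
    using surface_short_chart_segments[OF q zero_less_one] by blast
  have "path_component surface q q'" if q': "q' \<in> surface \<inter> ball q r" for q'
  proof -
    obtain c u w where c: "short_chart_segment 1 c u w" "chart_inv c u = \<phi>inv q" "chart_inv c w = \<phi>inv q'"
      using r(2)[OF _ q', of q] q r(1) by auto
    have seg: "c \<in> A" "closed_segment u w \<subseteq> chart_img c"
      using c(1) unfolding short_chart_segment_def by blast+
    have "continuous_map (top_of_set {0..1}) X (segment_curve c u w 0 1)"
      by (rule segment_curve_continuous[OF seg zero_less_one])
    then have path: "path (\<phi> \<circ> segment_curve c u w 0 1)" "path_image (\<phi> \<circ> segment_curve c u w 0 1) \<subseteq> surface"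
      by (simp_all add: path_embedded_curve pathin_def)
    have "\<phi> (\<phi>inv q) = q" "\<phi> (\<phi>inv q') = q'"
      using q q' by (simp_all add: f_inv_into_f)
    then have "pathstart (\<phi> \<circ> segment_curve c u w 0 1) = q" "pathfinish (\<phi> \<circ> segment_curve c u w 0 1) = q'"
      unfolding pathstart_def pathfinish_def comp_apply segment_curve_ends[OF seg zero_less_one] c
      by simp_all
    then show ?thesis
      using path unfolding path_component_def by blast
  qed
  then show "\<exists>T. openin (top_of_set surface) T \<and> q \<in> T \<and> (\<forall>q'\<in>T. path_component surface q q')"
    using q r(1) by (intro exI[of _ "surface \<inter> ball q r"]) (simp add: openin_open_Int)
qed (use path_component_sym path_component_trans in blast)+

end

section \<open>Comparison of the two distances\<close>

context embedded_manifold
begin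

abbreviation curves_between :: "'a \<Rightarrow> 'a \<Rightarrow> (real \<Rightarrow> 'a) set" where
  "curves_between x y \<equiv> {\<gamma>. piecewise_C1_curve X A \<gamma> \<and> \<gamma> 0 = x \<and> \<gamma> 1 = y}"

lemma embedded_curve_in_paths:
  assumes "surface \<subseteq> Y" "\<gamma> \<in> curves_between x y"
  shows "\<phi> \<circ> \<gamma> \<in> paths_in Y (\<phi> x) (\<phi> y)"
proof -
  have "pathin X \<gamma>" and ends: "\<gamma> 0 = x" "\<gamma> 1 = y"
    using assms(2) by (simp_all add: piecewise_C1_curve_def)
  from path_embedded_curve[OF this(1)] show ?thesis
    using assms(1) ends by (auto simp: pathstart_def pathfinish_def)
qed

lemma surface_rectifiably_joined:
  assumes "connected_space X" "surface \<subseteq> Y" and xy: "x \<in> topspace X" "y \<in> topspace X"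
  shows "rectifiably_joined Y (\<phi> x) (\<phi> y)"
proof -
  obtain \<eta> where \<eta>: "path \<eta>" "path_image \<eta> \<subseteq> surface" "\<eta> 0 = \<phi> x" "\<eta> 1 = \<phi> y"
    using surface_path_connected[OF assms(1), of "\<phi> x" "\<phi> y"] xy
    by (auto simp: path_component_def pathstart_def pathfinish_def)
  obtain \<gamma> where \<gamma>: "piecewise_C1_curve X A \<gamma>" "\<gamma> 0 = \<phi>inv (\<eta> 0)" "\<gamma> 1 = \<phi>inv (\<eta> 1)"
    by (rule polygonal_approximation[OF \<eta>(1,2) zero_less_one]) (rule that)
  then have "\<gamma> \<in> curves_between x y"
    using \<eta>(3,4) xy by (simp add: embedding_inj)
  then have "\<phi> \<circ> \<gamma> \<in> paths_in Y (\<phi> x) (\<phi> y)"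
    by (rule embedded_curve_in_paths[OF assms(2)])
  moreover have "curve_length (\<phi> \<circ> \<gamma>) < \<infinity>"
    using curve_length_le_riemannian_length[OF \<gamma>(1)] by (rule le_less_trans) simp
  ultimately show ?thesis
    unfolding rectifiably_joined_def by (intro bexI[of _ "\<phi> \<circ> \<gamma>"])
qed

text \<open>
  The two infima bound each other: a curve in the manifold is also a curve in \<open>Y\<close>, and a curve in
  \<open>Y\<close> is first retracted to the surface, which does not lengthen its chords, and then
  approximated there. For a convex set the retraction is the nearest-point projection.
\<close>
lemma riemannian_dist_eq_induced_length_dist:
  assumes "surface \<subseteq> Y"
    and retraction: "continuous_on Y \<pi>" "\<pi> ` Y \<subseteq> surface" "\<And>q. q \<in> surface \<Longrightarrow> \<pi> q = q"
      "\<And>z z'. \<lbrakk>z \<in> Y; z' \<in> Y\<rbrakk> \<Longrightarrow> dist (\<pi> z) (\<pi> z') \<le> dist z z'"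
    and xy: "x \<in> topspace X" "y \<in> topspace X"
  shows "riemannian_dist X A g x y = induced_length_dist Y (\<phi> x) (\<phi> y)"
proof -
  let ?R = "INF \<gamma>\<in>curves_between x y. ereal (riemannian_length A g \<gamma>)"
  let ?L = "INF \<gamma>\<in>paths_in Y (\<phi> x) (\<phi> y). curve_length \<gamma>"
  have "?L \<le> ?R"
  proof (rule INF_greatest)
    fix \<gamma> assume \<gamma>: "\<gamma> \<in> curves_between x y"
    then have "curve_length (\<phi> \<circ> \<gamma>) \<le> ereal (riemannian_length A g \<gamma>)"
      by (intro curve_length_le_riemannian_length) simp
    then show "?L \<le> ereal (riemannian_length A g \<gamma>)"
      by (rule INF_lower2[OF embedded_curve_in_paths[OF assms(1) \<gamma>]])
  qed
  moreover have "?R \<le> ?L"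
  proof (rule INF_greatest)
    fix \<sigma> assume \<sigma>: "\<sigma> \<in> paths_in Y (\<phi> x) (\<phi> y)"
    show "?R \<le> curve_length \<sigma>"
    proof (cases "curve_length \<sigma> = \<infinity>")
      case False
      then obtain L where L: "curve_length \<sigma> = ereal L" "L \<ge> 0"
        using curve_length_nonneg[of \<sigma>] by (cases "curve_length \<sigma>") auto
      have in_Y: "\<sigma> s \<in> Y" if "s \<in> {0..1}" for s
        using \<sigma> that unfolding path_image_def by blast
      define \<eta> where "\<eta> = \<pi> \<circ> \<sigma>"
      have "path \<eta>"
        unfolding \<eta>_def using \<sigma> by (intro path_continuous_image continuous_on_subset[OF retraction(1)]) auto
      moreover have "path_image \<eta> \<subseteq> surface"
        using retraction(2) in_Y unfolding \<eta>_def path_image_def by auto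
      moreover have \<eta>_ends: "\<phi>inv (\<eta> 0) = x" "\<phi>inv (\<eta> 1) = y"
        using \<sigma> retraction(3) xy by (auto simp: \<eta>_def pathstart_def pathfinish_def embedding_inj)
      ultimately have approx: "?R \<le> ereal ((1 + e) * L)" if "e > 0" for e
      proof -
        obtain \<gamma> n t where \<gamma>: "piecewise_C1_curve X A \<gamma>" "\<gamma> 0 = \<phi>inv (\<eta> 0)" "\<gamma> 1 = \<phi>inv (\<eta> 1)"
          and t: "t 0 = 0" "t n = 1" "\<forall>i<n. t i \<le> t (Suc i)"
          and le: "riemannian_length A g \<gamma> \<le> (1 + e) * (\<Sum>i<n. dist (\<eta> (t i)) (\<eta> (t (Suc i))))"
          by (rule polygonal_approximation[OF \<open>path \<eta>\<close> \<open>path_image \<eta> \<subseteq> surface\<close> \<open>e > 0\<close>]) (rule that)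
        have "(\<Sum>i<n. dist (\<eta> (t i)) (\<eta> (t (Suc i)))) \<le> (\<Sum>i<n. dist (\<sigma> (t i)) (\<sigma> (t (Suc i))))"
          unfolding \<eta>_def comp_apply
          by (intro sum_mono retraction(4) in_Y partition_in_unit_interval[OF t(1,2) t(3)[rule_format]]) auto
        also have "\<dots> \<le> L"
          using polygon_le_curve_length[OF t(1,2) t(3)[rule_format], of \<sigma>] L by simp
        finally have "(1 + e) * (\<Sum>i<n. dist (\<eta> (t i)) (\<eta> (t (Suc i)))) \<le> (1 + e) * L"
          using \<open>e > 0\<close> by (intro mult_left_mono) auto
        then have "ereal (riemannian_length A g \<gamma>) \<le> ereal ((1 + e) * L)"
          using le by simp
        moreover have "\<gamma> \<in> curves_between x y"
          using \<gamma> \<eta>_ends by simp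
        ultimately show ?thesis
          by (rule INF_lower2[rotated])
      qed
      show ?thesis
        unfolding L(1)
      proof (rule ereal_le_epsilon2)
        fix e :: real assume "e > 0"
        \<comment> \<open>Adding 1 to \<open>L\<close> keeps the quotient meaningful for curves of length 0.\<close>
        have "(1 + e / (L + 1)) * L \<le> L + e"
          using \<open>e > 0\<close> L(2) by (simp add: field_simps)
        then show "?R \<le> ereal L + ereal e"
          using approx[of "e / (L + 1)"] \<open>e > 0\<close> L(2) by (simp add: order_trans)
      qed
    qed simp
  qed
  ultimately have "?R = ?L"
    by (rule order_antisym[rotated])
  then show ?thesis
    unfolding riemannian_dist_def induced_length_dist_def by simp
qed

text \<open>
  The locale of metric spaces demands nonnegativity and symmetry at all points of the type. Outside
  the manifold there are no curves, the infimum is infinite, and its real value is 0.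
\<close>
lemma riemannian_dist_outside:
  assumes "x \<notin> topspace X \<or> y \<notin> topspace X"
  shows "riemannian_dist X A g x y = 0"
proof -
  have "curves_between x y = {}"
  proof (rule equals0I)
    fix \<gamma> assume "\<gamma> \<in> curves_between x y"
    then have "continuous_map (top_of_set {0..1}) X \<gamma>" "\<gamma> 0 = x" "\<gamma> 1 = y"
      by (simp_all add: piecewise_C1_curve_def pathin_def)
    moreover from continuous_map_image_subset_topspace[OF this(1)]
    have "\<gamma> 0 \<in> topspace X" "\<gamma> 1 \<in> topspace X"
      by auto
    ultimately show False
      using assms by simp
  qed
  then show ?thesis
    unfolding riemannian_dist_def by (simp only: image_empty Inf_empty) (simp add: top_ereal_def)
qed

end

theorem theorem3p2:
  fixes X :: "'a topology"
    and A :: "('a, 'b::euclidean_space) chart set"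
    and g :: "'a \<Rightarrow> ('a, 'b) tangent \<Rightarrow> ('a, 'b) tangent \<Rightarrow> real"
    and \<phi> :: "'a \<Rightarrow> 'e::euclidean_space"
    and K :: "'e set"
  assumes "DIM('e) = DIM('b) + 1"
    and "riemannian_manifold X A g"
    and "connected_space X"
    and "riemannian_isometric_embedding X A g \<phi>"
    and "closed K" and "convex K"
    and "\<phi> ` topspace X = frontier K"
  shows "metric_isometric_embedding
           (topspace X) (riemannian_dist X A g)
           (closure (UNIV - K)) (induced_length_dist (closure (UNIV - K))) \<phi>"
proof -
  let ?Z = "closure (UNIV - K)"
  interpret embedded_manifold X A g \<phi>
    by unfold_locales (use assms(2,4) in \<open>simp_all add: riemannian_manifold_def\<close>)
  have sub: "\<phi> ` topspace X \<subseteq> ?Z"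
    unfolding assms(7) exterior_closure[OF assms(5)] by blast
  have frontier: "rectifiably_joined ?Z q q'" if "q \<in> frontier K" "q' \<in> frontier K" for q q'
    using that surface_rectifiably_joined[OF assms(3) sub] unfolding assms(7)[symmetric] by blast
  have Z: "Metric_space ?Z (induced_length_dist ?Z)"
    by (rule Metric_space_induced_length_dist) (rule exterior_rectifiably_joined[OF assms(5) frontier])
  have eq: "riemannian_dist X A g x y = induced_length_dist ?Z (\<phi> x) (\<phi> y)"
    if xy: "x \<in> topspace X" "y \<in> topspace X" for x y
  proof (rule riemannian_dist_eq_induced_length_dist[OF sub, where \<pi> = "closest_point K"])
    have "frontier K \<subseteq> K"
      using assms(5) frontier_subset_closed by blast
    moreover have "\<phi> x \<in> frontier K"
      using xy assms(7) by blast
    ultimately have K: "K \<noteq> {}"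
      by blast
    show "continuous_on ?Z (closest_point K)"
      by (rule continuous_on_closest_point[OF assms(6,5) K])
    show "closest_point K ` ?Z \<subseteq> \<phi> ` topspace X"
      unfolding assms(7) using closest_point_in_frontier[OF assms(5) K] by blast
    show "closest_point K q = q" if "q \<in> \<phi> ` topspace X" for q
      using that \<open>frontier K \<subseteq> K\<close> unfolding assms(7) by (intro closest_point_self) blast
    show "dist (closest_point K z) (closest_point K z') \<le> dist z z'" for z z'
      by (rule closest_point_lipschitz[OF assms(6,5) K])
  qed (use xy in auto)
  interpret Z: Metric_space ?Z "induced_length_dist ?Z"
    by (rule Z)
  have M: "Metric_space (topspace X) (riemannian_dist X A g)"
  proof
    fix x y
    consider "x \<in> topspace X" "y \<in> topspace X" | "x \<notin> topspace X \<or> y \<notin> topspace X"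
      by blast
    note cases = this
    show "0 \<le> riemannian_dist X A g x y"
      by (cases rule: cases) (simp_all only: eq Z.nonneg riemannian_dist_outside order_refl)
    show "riemannian_dist X A g x y = riemannian_dist X A g y x"
    proof (cases rule: cases)
      case 1
      then show ?thesis
        by (simp only: eq) (rule Z.commute)
    next
      case 2
      then show ?thesis
        using riemannian_dist_outside[of x y] riemannian_dist_outside[of y x] by (simp only: disj_commute)
    qed
  next
    fix x y assume "x \<in> topspace X" "y \<in> topspace X"
    then show "riemannian_dist X A g x y = 0 \<longleftrightarrow> x = y"
      using eq sub embedding_inj by (simp add: inj_on_eq_iff image_subset_iff)
  next
    fix x y z assume "x \<in> topspace X" "y \<in> topspace X" "z \<in> topspace X"
    then show "riemannian_dist X A g x z \<le> riemannian_dist X A g x y + riemannian_dist X A g y z"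
      using eq sub Z.triangle by (simp add: image_subset_iff)
  qed
  show ?thesis
    unfolding metric_isometric_embedding_def Metric_space12_def using M Z sub eq by auto
qed

end
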